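(* Let $n\geq 0$ be an integer with $n\neq 3$, and let $(\mathbb{S}^{2n+1},\xi_0=\ker\alpha_0)$ be the standard contact sphere with its standard contact form $\alpha_0$. The class in $\pi_1(\operatorname{Cont}(\mathbb{S}^{2n+1},\xi_0))$ generated by the Reeb flow of $\alpha_0$ is a non-trivial element of infinite order.
   Context: $\mathbb{S}^{2n+1}$ is the unit sphere of $\mathbb{C}^{n+1}$ with coordinates $z_j=x_j+iy_j$, and $\alpha_0$ is the restriction of $\sum_j (x_j\,dy_j-y_j\,dx_j)$. $\operatorname{Cont}(M,\xi)=\{s\in\operatorname{Diff}(M): ds_*\xi=\xi\}$ is the group of contactomorphisms with the $C^\infty$ topology, based at the identity. The Reeb vector field $R$ of a contact form $\alpha$ is the unique vector field with $i_R\alpha=1$, $i_Rd\alpha=0$. The Reeb flow of $\alpha_0$ is periodic and gives the loop of contactomorphisms $z\mapsto e^{it}z$, $t\in[0,2\pi]$, whose homotopy class is the class referred to in the claim. *)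

theory Defs
  imports "HOL-Analysis.Analysis" "HOL-Algebra.Multiplicative_Group"
begin

section \<open>The fundamental group of a topological space\<close>

definition loop_at :: "'a topology \<Rightarrow> 'a \<Rightarrow> (real \<Rightarrow> 'a) \<Rightarrow> bool"
  where "loop_at X a p \<longleftrightarrow> pathin X p \<and> p 0 = a \<and> p 1 = a"

text \<open>Homotopy of loops relative to the end points; both arguments are then loops at \<open>a\<close>.
  Paths are total functions on the reals of which only the values on \<open>{0..1}\<close> matter.\<close>

definition loop_homotopic :: "'a topology \<Rightarrow> 'a \<Rightarrow> (real \<Rightarrow> 'a) \<Rightarrow> (real \<Rightarrow> 'a) \<Rightarrow> bool"
  where "loop_homotopic X a =
    homotopic_with (\<lambda>p. p 0 = a \<and> p 1 = a) (top_of_set {0..1}) X"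

definition loop_class :: "'a topology \<Rightarrow> 'a \<Rightarrow> (real \<Rightarrow> 'a) \<Rightarrow> (real \<Rightarrow> 'a) set"
  where "loop_class X a p = {q. loop_homotopic X a p q}"

text \<open>The same formula as \<^const>\<open>joinpaths\<close>, without its sort constraint: here the topology on
  the type \<open>'a\<close> is given by an explicit \<open>X\<close>.\<close>

definition loop_concat :: "(real \<Rightarrow> 'a) \<Rightarrow> (real \<Rightarrow> 'a) \<Rightarrow> real \<Rightarrow> 'a"
  where "loop_concat p q = (\<lambda>t. if t \<le> 1/2 then p (2 * t) else q (2 * t - 1))"

definition fundamental_group :: "'a topology \<Rightarrow> 'a \<Rightarrow> (real \<Rightarrow> 'a) set monoid"
  where "fundamental_group X a =
    \<lparr>carrier = loop_class X a ` {p. loop_at X a p},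
     mult = \<lambda>A B. \<Union>p\<in>A. \<Union>q\<in>B. loop_class X a (loop_concat p q),
     one = loop_class X a (\<lambda>_. a)\<rparr>"

lemma loop_homotopic_refl: "loop_homotopic X a p p \<longleftrightarrow> loop_at X a p"
  by (simp add: loop_homotopic_def loop_at_def pathin_def)

lemma loop_homotopic_sym: "loop_homotopic X a p q \<Longrightarrow> loop_homotopic X a q p"
  unfolding loop_homotopic_def by (rule homotopic_with_symD)

lemma loop_homotopic_trans:
  "loop_homotopic X a p q \<Longrightarrow> loop_homotopic X a q r \<Longrightarrow> loop_homotopic X a p r"
  unfolding loop_homotopic_def by (rule homotopic_with_trans)

lemma loop_homotopic_imp_loop:
  assumes "loop_homotopic X a p q"
  shows "loop_at X a p" "loop_at X a q"
  using loop_homotopic_sym loop_homotopic_trans assms loop_homotopic_refl by metis+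

lemma loop_class_eq_iff:
  assumes "loop_at X a p"
  shows "loop_class X a p = loop_class X a q \<longleftrightarrow> loop_homotopic X a p q"
  using assms loop_homotopic_refl loop_homotopic_sym loop_homotopic_trans
  unfolding loop_class_def by (metis (lifting) mem_Collect_eq Collect_cong)

lemma loop_homotopic_reparam:
  assumes p: "pathin X p"
    and f: "continuous_on {0..1} f" "f \<in> {0..1} \<rightarrow> {0..1}" "p (f 0) = a" "p (f 1) = a"
    and g: "continuous_on {0..1} g" "g \<in> {0..1} \<rightarrow> {0..1}" "g 0 = f 0" "g 1 = f 1"
    and P: "\<And>t. t \<in> {0..1} \<Longrightarrow> P t = p (f t)" and Q: "\<And>t. t \<in> {0..1} \<Longrightarrow> Q t = p (g t)"
  shows "loop_homotopic X a P Q"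
proof -
  let ?h = "\<lambda>y::real \<times> real. (1 - fst y) * f (snd y) + fst y * g (snd y)"
  have eq: "prod_topology (top_of_set {0..1}) (top_of_set {0..1}) = top_of_set ({0..1::real} \<times> {0..1::real})"
    by simp
  have "continuous_on ({0..1} \<times> {0..1}) (\<lambda>y::real \<times> real. f (snd y))"
    "continuous_on ({0..1} \<times> {0..1}) (\<lambda>y::real \<times> real. g (snd y))"
    by (rule continuous_on_compose2[OF f(1)] continuous_on_compose2[OF g(1)];
        auto intro: continuous_intros)+
  then have "continuous_on ({0..1} \<times> {0..1}) ?h"
    by (intro continuous_intros)
  moreover have "?h \<in> {0..1} \<times> {0..1} \<rightarrow> {0..1}"
  proof (clarsimp)
    fix s t :: real assume st: "0 \<le> s" "s \<le> 1" "0 \<le> t" "t \<le> 1"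
    then have "f t \<in> {0..1}" "g t \<in> {0..1}" using f(2) g(2) by auto
    then show "0 \<le> (1 - s) * f t + s * g t \<and> (1 - s) * f t + s * g t \<le> 1"
      using st convex_bound_le[of "f t" 1 "g t" "1 - s" s] by auto
  qed
  ultimately have "continuous_map (prod_topology (top_of_set {0..1}) (top_of_set {0..1}))
      (top_of_set {0..1}) ?h"
    unfolding eq by (auto simp: continuous_map_in_subtopology image_subset_iff Pi_iff)
  then have ch: "continuous_map (prod_topology (top_of_set {0..1}) (top_of_set {0..1})) X (p \<circ> ?h)"
    using p unfolding pathin_def by (rule continuous_map_compose)
  have "f 0 \<in> {0..1}" by (use f(2) in auto)
  show ?thesis
    unfolding loop_homotopic_def
    apply (subst homotopic_with)
    subgoal by auto
    apply (rule exI[of _ "p \<circ> ?h"])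
    using ch P Q f g by (auto simp: algebra_simps)
qed

lemma loop_concat_loop:
  assumes "loop_at X a p" "loop_at X a q"
  shows "loop_at X a (loop_concat p q)"
proof -
  have "continuous_map (top_of_set {0..1}) X (\<lambda>t::real. if t \<le> 1/2 then p (2*t) else q (2*t-1))"
  proof (rule continuous_map_cases_le)
    show "continuous_map (subtopology (top_of_set {0..1}) {x \<in> topspace (top_of_set {0..1}). x \<le> 1/2}) X (\<lambda>t::real. p (2*t))"
      by (rule continuous_map_compose[of _ "top_of_set {0..1::real}" "\<lambda>t. 2*t" X p, unfolded o_def])
         (use assms in \<open>auto simp: loop_at_def pathin_def continuous_map_in_subtopology subtopology_subtopology intro!: continuous_intros\<close>)
    show "continuous_map (subtopology (top_of_set {0..1}) {x \<in> topspace (top_of_set {0..1}). 1/2 \<le> x}) X (\<lambda>t::real. q (2*t-1))"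
      by (rule continuous_map_compose[of _ "top_of_set {0..1::real}" "\<lambda>t. 2*t-1" X q, unfolded o_def])
         (use assms in \<open>auto simp: loop_at_def pathin_def continuous_map_in_subtopology subtopology_subtopology intro!: continuous_intros\<close>)
    show "p (2*t) = q (2*t-1)" if "t = 1/2" for t
    proof -
      have "2 * t = 1" "2 * t - 1 = 0" using that by linarith+
      then show ?thesis using assms by (simp only: loop_at_def)
    qed
  qed (auto intro!: continuous_intros)
  then show ?thesis
    using assms by (auto simp: loop_at_def pathin_def loop_concat_def)
qed

lemma loop_concat_cong:
  assumes p: "loop_homotopic X a p p'" and q: "loop_homotopic X a q q'"
  shows "loop_homotopic X a (loop_concat p q) (loop_concat p' q')"
proof -
  let ?I = "top_of_set {0..1::real}"
  obtain h where h: "continuous_map (prod_topology ?I ?I) X h"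
      "\<And>x. h (0, x) = p x" "\<And>x. h (1, x) = p' x" "\<And>t. t \<in> {0..1} \<Longrightarrow> h (t, 0) = a \<and> h (t, 1) = a"
    using p unfolding loop_homotopic_def homotopic_with_def by (metis (no_types, lifting))
  obtain k where k: "continuous_map (prod_topology ?I ?I) X k"
      "\<And>x. k (0, x) = q x" "\<And>x. k (1, x) = q' x" "\<And>t. t \<in> {0..1} \<Longrightarrow> k (t, 0) = a \<and> k (t, 1) = a"
    using q unfolding loop_homotopic_def homotopic_with_def by (metis (no_types, lifting))
  have eq: "prod_topology ?I ?I = top_of_set ({0..1} \<times> {0..1})" by simp
  let ?H = "\<lambda>y::real \<times> real. if snd y \<le> 1/2 then h (fst y, 2 * snd y) else k (fst y, 2 * snd y - 1)"
  have "continuous_map (top_of_set ({0..1} \<times> {0..1})) X ?H"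
  proof (rule continuous_map_cases_le)
    show "continuous_map (subtopology (top_of_set ({0..1} \<times> {0..1}))
        {x \<in> topspace (top_of_set ({0..1} \<times> {0..1})). snd x \<le> 1/2}) X (\<lambda>y::real \<times> real. h (fst y, 2 * snd y))"
      by (rule continuous_map_compose[OF _ h(1)[unfolded eq], of _ "\<lambda>y. (fst y, 2 * snd y)", unfolded o_def])
         (auto simp: continuous_map_in_subtopology subtopology_subtopology intro!: continuous_intros)
    show "continuous_map (subtopology (top_of_set ({0..1} \<times> {0..1}))
        {x \<in> topspace (top_of_set ({0..1} \<times> {0..1})). 1/2 \<le> snd x}) X (\<lambda>y::real \<times> real. k (fst y, 2 * snd y - 1))"
      by (rule continuous_map_compose[OF _ k(1)[unfolded eq], of _ "\<lambda>y. (fst y, 2 * snd y - 1)", unfolded o_def])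
         (auto simp: continuous_map_in_subtopology subtopology_subtopology intro!: continuous_intros)
    show "h (fst y, 2 * snd y) = k (fst y, 2 * snd y - 1)"
      if "y \<in> topspace (top_of_set ({0..1} \<times> {0..1}))" "snd y = 1/2" for y
    proof -
      have "2 * snd y = 1" "2 * snd y - 1 = 0" "fst y \<in> {0..1}" using that by auto
      then show ?thesis using h(4) k(4) by (simp only:)
    qed
  qed (auto intro!: continuous_intros)
  then show ?thesis
    unfolding loop_homotopic_def homotopic_with_def
    by (intro exI[of _ ?H]) (use h k in \<open>auto simp: loop_concat_def\<close>)
qed

lemma loop_concat_assoc:
  assumes "loop_at X a p" "loop_at X a q" "loop_at X a r"
  shows "loop_homotopic X a (loop_concat (loop_concat p q) r) (loop_concat p (loop_concat q r))"
proof -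
  let ?g = "\<lambda>t::real. max (t/2) (max (t - 1/4) (2*t - 1))"
  show ?thesis
  proof (rule loop_homotopic_reparam[where p = "loop_concat (loop_concat p q) r" and f = id and g = ?g])
    show "pathin X (loop_concat (loop_concat p q) r)"
      using loop_concat_loop[OF loop_concat_loop[OF assms(1,2)] assms(3)] by (simp add: loop_at_def)
    show "continuous_on {0..1} ?g" by (intro continuous_intros) auto
    show "loop_concat p (loop_concat q r) t = loop_concat (loop_concat p q) r (?g t)" if "t \<in> {0..1}" for t
    proof -
      consider "t \<le> 1/2" | "1/2 < t" "t \<le> 3/4" | "3/4 < t" by linarith
      then show ?thesis
      proof cases
        case 1
        then have "?g t = t/2" by linarith
        then show ?thesis using 1 by (simp add: loop_concat_def)
      next
        case 2
        then have "?g t = t - 1/4" by linarith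
        then show ?thesis using 2 by (simp add: loop_concat_def algebra_simps)
      next
        case 3
        then have "?g t = 2*t - 1" by linarith
        then show ?thesis using 3 by (simp add: loop_concat_def algebra_simps)
      qed
    qed
    show "?g \<in> {0..1} \<rightarrow> {0..1}"
    proof
      fix t :: real assume "t \<in> {0..1}"
      then have "0 \<le> ?g t" "?g t \<le> 1" by (simp_all add: le_max_iff_disj)
      then show "?g t \<in> {0..1}" by simp
    qed
  qed (use assms in \<open>auto simp: loop_at_def loop_concat_def\<close>)
qed

lemma loop_concat_const_left:
  assumes "loop_at X a p"
  shows "loop_homotopic X a (loop_concat (\<lambda>_. a) p) p"
proof (rule loop_homotopic_reparam[where p = p and f = "\<lambda>t. max 0 (2*t - 1)" and g = id])
  show "loop_concat (\<lambda>_. a) p t = p (max 0 (2*t - 1))" for t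
    using assms by (cases "t \<le> 1/2") (auto simp: loop_at_def loop_concat_def)
qed (use assms in \<open>auto simp: loop_at_def intro!: continuous_intros\<close>)

lemma loop_reverse_loop:
  assumes "loop_at X a p"
  shows "loop_at X a (\<lambda>t. p (1 - t))"
proof -
  have "loop_homotopic X a (\<lambda>t. p (1 - t)) (\<lambda>t. p (1 - t))"
    by (rule loop_homotopic_reparam[where p = p and f = "\<lambda>t. 1 - t" and g = "\<lambda>t. 1 - t"])
       (use assms in \<open>auto simp: loop_at_def intro!: continuous_intros\<close>)
  then show ?thesis by (simp add: loop_homotopic_refl)
qed

lemma loop_concat_reverse:
  assumes "loop_at X a p"
  shows "loop_homotopic X a (loop_concat (\<lambda>t. p (1 - t)) p) (\<lambda>_. a)"
  by (rule loop_homotopic_reparam[where p = p and f = "\<lambda>t. \<bar>1 - 2*t\<bar>" and g = "\<lambda>_. 1"])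
     (use assms in \<open>auto simp: loop_at_def loop_concat_def intro!: continuous_intros\<close>)

lemma loop_at_const: "a \<in> topspace X \<Longrightarrow> loop_at X a (\<lambda>_. a)"
  by (simp add: loop_at_def pathin_def)

lemma fundamental_group_simps:
  "carrier (fundamental_group X a) = loop_class X a ` {p. loop_at X a p}"
  "\<one>\<^bsub>fundamental_group X a\<^esub> = loop_class X a (\<lambda>_. a)"
  by (simp_all add: fundamental_group_def)

lemma fundamental_group_mult:
  assumes "loop_at X a p" "loop_at X a q"
  shows "loop_class X a p \<otimes>\<^bsub>fundamental_group X a\<^esub> loop_class X a q = loop_class X a (loop_concat p q)"
proof -
  have "loop_class X a (loop_concat p' q') = loop_class X a (loop_concat p q)"
    if "p' \<in> loop_class X a p" "q' \<in> loop_class X a q" for p' q'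
  proof -
    have "loop_homotopic X a (loop_concat p q) (loop_concat p' q')"
      using that by (intro loop_concat_cong) (simp_all add: loop_class_def)
    then show ?thesis
      by (subst eq_commute) (simp add: loop_class_eq_iff loop_concat_loop assms)
  qed
  then have "(\<Union>p'\<in>loop_class X a p. \<Union>q'\<in>loop_class X a q. loop_class X a (loop_concat p' q'))
      = (\<Union>p'\<in>loop_class X a p. \<Union>q'\<in>loop_class X a q. loop_class X a (loop_concat p q))"
    by (intro SUP_cong refl)
  moreover have "loop_class X a p \<noteq> {}" "loop_class X a q \<noteq> {}"
    using assms unfolding loop_class_def by (auto simp flip: loop_homotopic_refl)
  ultimately show ?thesis
    by (simp add: fundamental_group_def)
qed

proposition group_fundamental_group:
  assumes "a \<in> topspace X"
  shows "group (fundamental_group X a)"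
proof (rule groupI)
  fix x assume "x \<in> carrier (fundamental_group X a)"
  then obtain p where p: "loop_at X a p" "x = loop_class X a p"
    by (auto simp: fundamental_group_simps)
  show "\<exists>y\<in>carrier (fundamental_group X a). y \<otimes>\<^bsub>fundamental_group X a\<^esub> x = \<one>\<^bsub>fundamental_group X a\<^esub>"
    using p loop_reverse_loop[OF p(1)] loop_concat_reverse[OF p(1)]
    by (intro bexI[of _ "loop_class X a (\<lambda>t. p (1 - t))"])
       (auto simp: fundamental_group_mult fundamental_group_simps loop_class_eq_iff loop_concat_loop)
next
  fix x y z assume "x \<in> carrier (fundamental_group X a)" "y \<in> carrier (fundamental_group X a)"
    "z \<in> carrier (fundamental_group X a)"
  then obtain p q r where pqr: "loop_at X a p" "loop_at X a q" "loop_at X a r"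
    "x = loop_class X a p" "y = loop_class X a q" "z = loop_class X a r"
    by (auto simp: fundamental_group_simps)
  have "loop_class X a (loop_concat (loop_concat p q) r) = loop_class X a (loop_concat p (loop_concat q r))"
    using pqr by (intro loop_class_eq_iff[THEN iffD2] loop_concat_assoc loop_concat_loop)
  then show "x \<otimes>\<^bsub>fundamental_group X a\<^esub> y \<otimes>\<^bsub>fundamental_group X a\<^esub> z =
      x \<otimes>\<^bsub>fundamental_group X a\<^esub> (y \<otimes>\<^bsub>fundamental_group X a\<^esub> z)"
    using pqr by (simp add: fundamental_group_mult loop_concat_loop)
next
  fix x assume "x \<in> carrier (fundamental_group X a)"
  then obtain p where p: "loop_at X a p" "x = loop_class X a p"
    by (auto simp: fundamental_group_simps)
  have "loop_class X a (loop_concat (\<lambda>_. a) p) = loop_class X a p"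
    using p assms by (intro loop_class_eq_iff[THEN iffD2] loop_concat_const_left loop_concat_loop loop_at_const)
  then show "\<one>\<^bsub>fundamental_group X a\<^esub> \<otimes>\<^bsub>fundamental_group X a\<^esub> x = x"
    using p assms by (simp add: fundamental_group_mult fundamental_group_simps loop_at_const)
qed (use assms in \<open>auto simp: fundamental_group_mult fundamental_group_simps loop_concat_loop loop_at_const\<close>)


section \<open>Smooth maps and diffeomorphisms of the unit sphere\<close>

text \<open>Iterated directional derivatives. A map is smooth on an open set iff all of them exist
  there and are totally differentiable.\<close>

primrec dir_derivs :: "'a list \<Rightarrow> ('a::real_normed_vector \<Rightarrow> 'b::real_normed_vector) \<Rightarrow> 'a \<Rightarrow> 'b"
  where
    "dir_derivs [] f = f"
  | "dir_derivs (v # vs) f = (\<lambda>x. frechet_derivative (dir_derivs vs f) (at x) v)"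

definition smooth_on_open :: "'a set \<Rightarrow> ('a::euclidean_space \<Rightarrow> 'b::euclidean_space) \<Rightarrow> bool"
  where "smooth_on_open U f \<longleftrightarrow> open U \<and> (\<forall>vs. \<forall>x\<in>U. dir_derivs vs f differentiable (at x))"

text \<open>Smoothness on an arbitrary subset of Euclidean space, through local smooth extensions.\<close>

definition smooth_map_on :: "'a set \<Rightarrow> ('a::euclidean_space \<Rightarrow> 'b::euclidean_space) \<Rightarrow> bool"
  where "smooth_map_on S f \<longleftrightarrow>
    (\<forall>x\<in>S. \<exists>U F. x \<in> U \<and> smooth_on_open U F \<and> (\<forall>y\<in>S \<inter> U. F y = f y))"

text \<open>Self-maps of \<open>S\<close> are represented by functions in \<^term>\<open>extensional S\<close>, so that equality of
  maps on \<open>S\<close> is equality.\<close>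

definition diffeos :: "'a set \<Rightarrow> ('a::euclidean_space \<Rightarrow> 'a) set"
  where "diffeos S = {s \<in> extensional S. bij_betw s S S \<and>
    smooth_map_on S s \<and> smooth_map_on S (inv_into S s)}"

text \<open>\<^term>\<open>sgn\<close> is the radial retraction \<open>x \<mapsto> x / norm x\<close> onto the unit sphere, so \<^term>\<open>s \<circ> sgn\<close> is
  the extension of a map \<open>s\<close> of the sphere that is constant along rays; it is smooth away from \<open>0\<close>
  iff \<open>s\<close> is smooth. The \<open>C\<^sup>\<infinity>\<close> topology is that of uniform convergence on the (compact) sphere of
  all iterated derivatives of these extensions, including the ones of order \<open>0\<close>. As the sphere is
  compact and the derivatives are continuous, the sets \<open>cinf_ball f vs e\<close> are the
  open balls of the corresponding sup-seminorms.\<close>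

definition cinf_ball :: "('a::euclidean_space \<Rightarrow> 'a) \<Rightarrow> 'a list \<Rightarrow> real \<Rightarrow> ('a \<Rightarrow> 'a) set"
  where "cinf_ball f vs e = {g \<in> diffeos (sphere 0 1). \<forall>z\<in>sphere 0 1.
    norm (dir_derivs vs (g \<circ> sgn) z - dir_derivs vs (f \<circ> sgn) z) < e}"

definition cinf_topology :: "('a::euclidean_space \<Rightarrow> 'a) topology"
  where "cinf_topology = topology_generated_by
    {cinf_ball f vs e | f vs e. f \<in> diffeos (sphere 0 1) \<and> e > 0}"

lemma topspace_cinf_topology: "topspace cinf_topology = diffeos (sphere 0 1)"
proof -
  have "cinf_ball f vs e \<subseteq> diffeos (sphere 0 1)" for f :: "'a \<Rightarrow> 'a" and vs e
    by (auto simp: cinf_ball_def)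
  moreover have "f \<in> cinf_ball f [] 1" if "f \<in> diffeos (sphere 0 1)" for f :: "'a \<Rightarrow> 'a"
    using that by (simp add: cinf_ball_def)
  ultimately show ?thesis
    unfolding cinf_topology_def topology_generated_by_topspace
    using zero_less_one[where 'a=real] by blast
qed

text \<open>The differential \<open>T\<^sub>z S \<rightarrow> T\<^sub>s\<^sub>z S\<close> of a smooth self-map of the unit sphere: the derivative of
  \<^term>\<open>sgn\<close> at a point \<open>z\<close> of the sphere is the orthogonal projection onto \<open>T\<^sub>z S\<close>, so on tangent
  vectors the derivative of the extension is the differential.\<close>

definition sphere_tangent :: "'a::euclidean_space \<Rightarrow> 'a set"
  where "sphere_tangent z = {v. z \<bullet> v = 0}"

definition sphere_differential :: "('a::euclidean_space \<Rightarrow> 'a) \<Rightarrow> 'a \<Rightarrow> 'a \<Rightarrow> 'a"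
  where "sphere_differential s z = frechet_derivative (s \<circ> sgn) (at z)"

lemma sphere_differential_curve:
  assumes "(s \<circ> sgn) differentiable (at (c t))"
    and c: "\<And>u. c u \<in> sphere 0 1" and d: "(c has_vector_derivative v) (at t)"
  shows "((s \<circ> c) has_vector_derivative sphere_differential s (c t) v) (at t)"
proof -
  have "((s \<circ> sgn) has_derivative sphere_differential s (c t)) (at (c t))"
    using assms(1) frechet_derivative_works unfolding sphere_differential_def by blast
  then have "((s \<circ> sgn \<circ> c) has_vector_derivative sphere_differential s (c t) v) (at t)"
    using vector_derivative_diff_chain_within[OF d] has_derivative_at_withinI by blast
  moreover have "s \<circ> sgn \<circ> c = s \<circ> c"
    using c by (auto simp: fun_eq_iff sgn_div_norm)
  ultimately show ?thesis by simp
qed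


section \<open>The standard contact sphere\<close>

definition alpha0 :: "complex ^ 'n \<Rightarrow> complex ^ 'n \<Rightarrow> real"
  where "alpha0 z v = (\<Sum>j\<in>UNIV. Re (z $ j) * Im (v $ j) - Im (z $ j) * Re (v $ j))"

definition xi0 :: "complex ^ 'n \<Rightarrow> (complex ^ 'n) set"
  where "xi0 z = {v \<in> sphere_tangent z. alpha0 z v = 0}"

definition contactomorphisms :: "(complex ^ 'n \<Rightarrow> complex ^ 'n) set"
  where "contactomorphisms = {s \<in> diffeos (sphere 0 1).
    \<forall>z\<in>sphere 0 1. sphere_differential s z ` xi0 z = xi0 (s z)}"

definition Cont_sphere :: "(complex ^ 'n \<Rightarrow> complex ^ 'n) topology"
  where "Cont_sphere = subtopology cinf_topology contactomorphisms"

definition id_sphere :: "complex ^ 'n \<Rightarrow> complex ^ 'n"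
  where "id_sphere = (\<lambda>z\<in>sphere 0 1. z)"

text \<open>The Reeb flow, defined by its explicit formula; that it is the flow of the Reeb vector field
  is \<open>reeb_flow_is_flow\<close> below. The exterior derivative is that of the ambient form on \<open>\<complex>\<^sup>n\<^sup>+\<^sup>1\<close>, restricted to
  tangent vectors of the sphere.\<close>

definition reeb_flow :: "real \<Rightarrow> complex ^ 'n \<Rightarrow> complex ^ 'n"
  where "reeb_flow t = (\<lambda>z\<in>sphere 0 1. cis t *s z)"

definition reeb_loop :: "real \<Rightarrow> complex ^ 'n \<Rightarrow> complex ^ 'n"
  where "reeb_loop t = reeb_flow (2 * pi * t)"

definition dalpha0 :: "complex ^ 'n \<Rightarrow> complex ^ 'n \<Rightarrow> complex ^ 'n \<Rightarrow> real"
  where "dalpha0 z u v = frechet_derivative (\<lambda>x. alpha0 x v) (at z) u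
    - frechet_derivative (\<lambda>x. alpha0 x u) (at z) v"

definition is_reeb_vector :: "complex ^ 'n \<Rightarrow> complex ^ 'n \<Rightarrow> bool"
  where "is_reeb_vector z R \<longleftrightarrow> R \<in> sphere_tangent z \<and> alpha0 z R = 1 \<and>
    (\<forall>v\<in>sphere_tangent z. dalpha0 z R v = 0)"

lemma linear_alpha0_left: "linear (\<lambda>x. alpha0 x v)"
  by (rule linearI) (simp_all add: alpha0_def algebra_simps sum.distrib sum_subtractf sum_distrib_left)

lemma alpha0_eq_inner: "alpha0 z v = (\<i> *s z) \<bullet> v"
  by (simp add: alpha0_def inner_vec_def inner_complex_def algebra_simps)

lemma alpha0_antisym: "alpha0 v z = - alpha0 z v"
  by (simp add: alpha0_def sum_negf[symmetric] algebra_simps)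

lemma dalpha0_eq:
  fixes z u v :: "complex ^ 'n"
  shows "dalpha0 z u v = 2 * alpha0 u v"
proof -
  have "((\<lambda>x. alpha0 x w) has_derivative (\<lambda>x. alpha0 x w)) (at z)" for w :: "complex ^ 'n"
    using linear_alpha0_left linear_imp_has_derivative by blast
  then have "frechet_derivative (\<lambda>x. alpha0 x w) (at z) = (\<lambda>x. alpha0 x w)" for w :: "complex ^ 'n"
    using frechet_derivative_at by metis
  then show ?thesis
    by (simp add: dalpha0_def alpha0_antisym[of v u])
qed

lemma is_reeb_vector_iff:
  fixes z R :: "complex ^ 'n"
  assumes "z \<in> sphere 0 1"
  shows "is_reeb_vector z R \<longleftrightarrow> R = \<i> *s z"
proof -
  have zz: "z \<bullet> z = 1" using assms by (simp add: dot_square_norm)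
  have ii: "(\<i> *s u) \<bullet> (\<i> *s w) = u \<bullet> w" "\<i> *s (\<i> *s u) = - u" "(\<i> *s u) \<bullet> u = 0" for u w :: "complex ^ 'n"
    by (auto simp: inner_vec_def inner_complex_def vec_eq_iff algebra_simps intro!: sum.neutral)
  show ?thesis
  proof
    assume "is_reeb_vector z R"
    then have R: "z \<bullet> R = 0" "(\<i> *s z) \<bullet> R = 1" "\<And>v. z \<bullet> v = 0 \<Longrightarrow> (\<i> *s R) \<bullet> v = 0"
      by (auto simp: is_reeb_vector_def sphere_tangent_def dalpha0_eq alpha0_eq_inner)
    have Rz: "(\<i> *s R) \<bullet> z = - 1"
      using R(2) alpha0_antisym[of R z] by (simp add: alpha0_eq_inner)
    define w where "w = \<i> *s R + z"
    have "z \<bullet> w = 0"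
      using Rz zz by (simp add: w_def inner_add_right inner_commute)
    then have "w \<bullet> w = 0"
      using R(3)[of w] by (simp add: w_def inner_add_left)
    then have "\<i> *s R + z = 0" by (simp add: w_def)
    then have "\<i> *s (\<i> *s R + z) = \<i> *s 0" by simp
    then show "R = \<i> *s z"
      by (simp add: vector_add_ldistrib ii)
  next
    assume "R = \<i> *s z"
    then show "is_reeb_vector z R"
      using zz ii(3)[of z] by (auto simp: is_reeb_vector_def sphere_tangent_def dalpha0_eq alpha0_eq_inner ii inner_commute)
  qed
qed

proposition reeb_flow_is_flow:
  assumes "z \<in> sphere 0 1"
  shows "reeb_flow 0 z = z" "reeb_flow t z \<in> sphere 0 1"
    "is_reeb_vector (reeb_flow t z) (vector_derivative (\<lambda>t. reeb_flow t z) (at t))"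
    "(\<lambda>t. reeb_flow t z) differentiable (at t)"
proof -
  show "reeb_flow 0 z = z" using assms by (simp add: reeb_flow_def)
  have "norm (cis t *s z) = norm z"
    by (simp add: norm_vec_def norm_mult)
  then show S: "reeb_flow t z \<in> sphere 0 1" using assms by (simp add: reeb_flow_def)
  have "((\<lambda>t. cis t *s z) has_vector_derivative (\<i> *s (cis t *s z))) (at t)"
  proof -
    have "linear (\<lambda>w. w *s z)"
      by (rule linearI) (simp_all add: vec_eq_iff algebra_simps)
    then have "bounded_linear (\<lambda>w. w *s z)"
      by (rule linear_conv_bounded_linear[THEN iffD1])
    moreover have "(cis has_vector_derivative \<i> * cis t) (at t)"
      by (auto simp: has_vector_derivative_complex_iff intro!: derivative_eq_intros)
    ultimately have "((\<lambda>t. cis t *s z) has_vector_derivative ((\<i> * cis t) *s z)) (at t)"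
      by (rule bounded_linear.has_vector_derivative)
    then show ?thesis by (simp add: vector_smult_assoc)
  qed
  then have *: "((\<lambda>t. reeb_flow t z) has_vector_derivative (\<i> *s reeb_flow t z)) (at t)"
    using assms by (simp add: reeb_flow_def)
  then show "is_reeb_vector (reeb_flow t z) (vector_derivative (\<lambda>t. reeb_flow t z) (at t))"
    using is_reeb_vector_iff[OF S] vector_derivative_at by blast
  show "(\<lambda>t. reeb_flow t z) differentiable (at t)"
    using * differentiableI_vector by blast
qed

end

theory Submission
  imports Defs "HOL-Complex_Analysis.Winding_Numbers"
begin

text \<open>Fix the base point \<open>p = e\<^sub>k\<close> of the sphere. A contactomorphism \<open>s\<close> with positive conformal
  factor extends at \<open>p\<close> to a real-linear automorphism of \<open>\<complex>\<^sup>n\<^sup>+\<^sup>1\<close>: the differential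
  \<open>\<xi>\<^sub>0 p \<rightarrow> \<xi>\<^sub>0 (s p)\<close>, which preserves \<open>d\<alpha>\<^sub>0\<close> up to the conformal factor, together with the
  complex-linear map \<open>\<complex> p \<rightarrow> \<complex> (s p)\<close> taking \<open>p\<close> to \<open>s p\<close>. As for symplectic matrices, its
  complex-linear part is invertible. The determinant of that part depends continuously on the 1-jet
  of \<open>s\<close> at \<open>p\<close>, so its winding number around \<open>0\<close> is a homotopy invariant of loops of
  contactomorphisms, a Maslov index. It is additive under concatenation, and \<open>n + 1\<close> on the Reeb loop,
  where the determinant is \<open>e\<^bsup>(n + 1)it\<^esup>\<close>.\<close>

section \<open>Calculus of smooth maps\<close>

text \<open>Smoothness is graded by order so that closure properties can be proved by induction on
  \<open>k\<close>. The order is shifted by one: \<open>diffk 0\<close> is plain differentiability,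
  and \<open>diffk k\<close> provides \<open>k + 1\<close> total derivatives.\<close>

definition diffk :: "nat \<Rightarrow> 'a set \<Rightarrow> ('a::real_normed_vector \<Rightarrow> 'b::real_normed_vector) \<Rightarrow> bool"
  where "diffk k U f \<longleftrightarrow> (\<forall>vs. length vs \<le> k \<longrightarrow> (\<forall>x\<in>U. dir_derivs vs f differentiable (at x)))"

lemma smooth_on_open_iff: "smooth_on_open U f \<longleftrightarrow> open U \<and> (\<forall>k. diffk k U f)"
  unfolding smooth_on_open_def diffk_def by blast

lemma dir_derivs_append: "dir_derivs (vs @ ws) f = dir_derivs vs (dir_derivs ws f)"
  by (induction vs) auto

lemma frechet_derivative_cong_open:
  assumes "open U" "x \<in> U" "\<And>y. y \<in> U \<Longrightarrow> f y = g y"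
  shows "frechet_derivative f (at x) = frechet_derivative g (at x)"
proof -
  have "(f has_derivative D) (at x) \<longleftrightarrow> (g has_derivative D) (at x)" for D
    using assms has_derivative_transform_within_open[of f D x UNIV U g]
      has_derivative_transform_within_open[of g D x UNIV U f] by auto
  then show ?thesis unfolding frechet_derivative_def by simp
qed

lemma dir_derivs_cong_open:
  assumes "open U" "x \<in> U" "\<And>y. y \<in> U \<Longrightarrow> f y = g y"
  shows "dir_derivs vs f x = dir_derivs vs g x"
  using assms(2)
proof (induction vs arbitrary: x)
  case (Cons v vs)
  then show ?case
    using frechet_derivative_cong_open[OF assms(1), of x "dir_derivs vs f" "dir_derivs vs g"] by simp
qed (use assms in auto)

lemma differentiable_cong_open:
  assumes "open U" "x \<in> U" "\<And>y. y \<in> U \<Longrightarrow> f y = g y" "f differentiable (at x)"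
  shows "g differentiable (at x)"
  using assms has_derivative_transform_within_open[of f _ x UNIV U g]
  unfolding differentiable_def by blast

lemma diffk_cong:
  assumes "open U" "\<And>x. x \<in> U \<Longrightarrow> f x = g x" "diffk k U f"
  shows "diffk k U g"
  unfolding diffk_def
proof (intro allI impI ballI)
  fix vs :: "'a list" and x :: 'a assume "length vs \<le> k" "x \<in> U"
  then have "dir_derivs vs f differentiable (at x)" using assms(3) unfolding diffk_def by blast
  then show "dir_derivs vs g differentiable (at x)"
    by (rule differentiable_cong_open[OF assms(1) \<open>x \<in> U\<close> dir_derivs_cong_open[OF assms(1)], rotated 2])
      (use assms(2) in auto)
qed

lemma diffk_0: "diffk 0 U f \<longleftrightarrow> (\<forall>x\<in>U. f differentiable (at x))"
  by (simp add: diffk_def)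

lemma diffk_mono: "diffk m U f \<Longrightarrow> k \<le> m \<Longrightarrow> diffk k U f"
  unfolding diffk_def using order_trans by blast

lemma diffk_subset: "diffk k U f \<Longrightarrow> V \<subseteq> U \<Longrightarrow> diffk k V f"
  unfolding diffk_def by blast

text \<open>\<open>dir_derivs\<close> recurses on the outermost derivative; splitting the list at
  its last entry peels off the innermost one instead. An induction on \<open>k\<close> can then pass
  from \<open>f\<close> to its first derivatives.\<close>

lemma diffk_Suc:
  "diffk (Suc k) U f \<longleftrightarrow> (\<forall>x\<in>U. f differentiable (at x)) \<and> (\<forall>v. diffk k U (dir_derivs [v] f))"
proof
  assume L: "diffk (Suc k) U f"
  then have "diffk 0 U f" by (rule diffk_mono) simp
  moreover have "diffk k U (dir_derivs [v] f)" for v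
    unfolding diffk_def
  proof (intro allI impI)
    fix vs :: "'a list" assume "length vs \<le> k"
    then have "length (vs @ [v]) \<le> Suc k" by simp
    then show "\<forall>x\<in>U. dir_derivs vs (dir_derivs [v] f) differentiable at x"
      using L unfolding diffk_def dir_derivs_append[symmetric] by blast
  qed
  ultimately show "(\<forall>x\<in>U. f differentiable (at x)) \<and> (\<forall>v. diffk k U (dir_derivs [v] f))"
    by (simp add: diffk_0)
next
  assume R: "(\<forall>x\<in>U. f differentiable (at x)) \<and> (\<forall>v. diffk k U (dir_derivs [v] f))"
  show "diffk (Suc k) U f"
    unfolding diffk_def
  proof (intro allI impI)
    fix vs :: "'a list" assume l: "length vs \<le> Suc k"
    show "\<forall>x\<in>U. dir_derivs vs f differentiable at x"
    proof (cases vs rule: rev_exhaust)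
      case Nil
      then show ?thesis using R by simp
    next
      case (snoc ws v)
      then show ?thesis
        using R l unfolding diffk_def snoc dir_derivs_append by simp
    qed
  qed
qed

lemma dir_derivs_single: "(f has_derivative D) (at x) \<Longrightarrow> dir_derivs [v] f x = D v"
  using frechet_derivative_at by fastforce

text \<open>Functions that agree on an open set have the same iterated derivatives there, so
  \<open>frechet_derivative\<close> may be traded for any explicit formula \<open>D\<close>.\<close>

lemma diffk_SucI:
  assumes "open U" "\<And>x. x \<in> U \<Longrightarrow> (f has_derivative D x) (at x)" "\<And>v. diffk k U (\<lambda>x. D x v)"
  shows "diffk (Suc k) U f"
proof -
  have "diffk k U (dir_derivs [v] f)" for v
    by (rule diffk_cong[OF assms(1) _ assms(3)]) (rule dir_derivs_single[OF assms(2), symmetric])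
  then show ?thesis
    using assms(2) unfolding diffk_Suc differentiable_def by blast
qed

lemma diffk_SucD:
  assumes "diffk (Suc k) U f"
  shows "\<And>x. x \<in> U \<Longrightarrow> (f has_derivative frechet_derivative f (at x)) (at x)"
    "\<And>v. diffk k U (\<lambda>x. frechet_derivative f (at x) v)"
  using assms by (simp_all add: diffk_Suc frechet_derivative_works)

section \<open>Closure under sums, products and composition\<close>

lemma diffk_const: "open U \<Longrightarrow> diffk k U (\<lambda>x. c)"
proof (induction k arbitrary: c)
  case (Suc k)
  show ?case by (rule diffk_SucI[OF Suc.prems, where D = "\<lambda>x v. 0"]) (auto intro: Suc)
qed (auto simp: diffk_0)

lemma diffk_linear:
  assumes "open U" "bounded_linear f"
  shows "diffk k U f"
proof (cases k)
  case 0
  then show ?thesis using assms by (auto simp: diffk_0 bounded_linear_imp_differentiable)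
next
  case (Suc k)
  show ?thesis unfolding Suc
    by (rule diffk_SucI[OF assms(1), where D = "\<lambda>x. f"])
      (auto intro: diffk_const assms bounded_linear_imp_has_derivative)
qed

lemma diffk_add:
  assumes "open U" "diffk k U f" "diffk k U g"
  shows "diffk k U (\<lambda>x. f x + g x)"
  using assms(2,3)
proof (induction k arbitrary: f g)
  case (Suc k)
  show ?case
    by (intro diffk_SucI[OF assms(1), where D = "\<lambda>x v. frechet_derivative f (at x) v + frechet_derivative g (at x) v"]
        has_derivative_add Suc.IH diffk_SucD[OF Suc.prems(1)] diffk_SucD[OF Suc.prems(2)])
qed (auto simp: diffk_0)

lemma diffk_sum:
  assumes "open U" "\<And>i. i \<in> I \<Longrightarrow> diffk k U (f i)"
  shows "diffk k U (\<lambda>x. \<Sum>i\<in>I. f i x)"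
  using assms(2) by (induction I rule: infinite_finite_induct) (auto intro!: diffk_const diffk_add assms(1))

lemma diffk_bilinear:
  assumes "bounded_bilinear P" "open U" "diffk k U f" "diffk k U g"
  shows "diffk k U (\<lambda>x. P (f x) (g x))"
  using assms(3,4)
proof (induction k arbitrary: f g)
  case 0
  then show ?case
    using bounded_bilinear.FDERIV[OF assms(1)] unfolding diffk_0 differentiable_def by blast
next
  case (Suc k)
  have "diffk k U f" "diffk k U g" using Suc.prems diffk_mono le_SucI by blast+
  then show ?case
    by (intro diffk_SucI[OF assms(2), where D = "\<lambda>x v. P (f x) (frechet_derivative g (at x) v)
        + P (frechet_derivative f (at x) v) (g x)"] bounded_bilinear.FDERIV[OF assms(1)] diffk_add
        Suc.IH diffk_SucD[OF Suc.prems(1)] diffk_SucD[OF Suc.prems(2)] assms(2))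
qed

lemma linear_expand_Basis:
  fixes v :: "'a::euclidean_space"
  assumes "linear L"
  shows "L v = (\<Sum>b\<in>Basis. (v \<bullet> b) *\<^sub>R L b)"
  using assms by (metis (no_types, lifting) euclidean_representation linear_sum linear_scale sum.cong)

text \<open>In the chain rule \<open>f\<close> is differentiated in a direction that moves with
  \<open>x\<close>, whereas \<open>diffk\<close> controls derivatives in fixed directions. Expanding
  the moving direction in \<open>Basis\<close> leaves sums of products to which the induction
  hypothesis and \<open>diffk_bilinear\<close> apply.\<close>

lemma diffk_compose:
  fixes f :: "'b::euclidean_space \<Rightarrow> 'c::real_normed_vector" and g :: "'a::real_normed_vector \<Rightarrow> 'b"
  assumes "open U" "open V" "g ` U \<subseteq> V" "diffk k U g" "diffk k V f"
  shows "diffk k U (\<lambda>x. f (g x))"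
  using assms(4,5)
proof (induction k arbitrary: f)
  case 0
  then show ?case
    using assms(3) differentiable_chain_at[of g _ f] by (auto simp: diffk_0 o_def)
next
  case (Suc k)
  let ?D = "\<lambda>x v. \<Sum>b\<in>Basis. (frechet_derivative g (at x) v \<bullet> b) *\<^sub>R frechet_derivative f (at (g x)) b"
  have g: "diffk k U g" using Suc.prems diffk_mono le_SucI by blast
  show ?case
  proof (rule diffk_SucI[OF assms(1), where D = ?D])
    fix x assume x: "x \<in> U"
    then have f': "(f has_derivative frechet_derivative f (at (g x))) (at (g x))"
      using diffk_SucD(1)[OF Suc.prems(2)] assms(3) by blast
    have "?D x = (\<lambda>v. frechet_derivative f (at (g x)) (frechet_derivative g (at x) v))"
      by (rule ext, rule linear_expand_Basis[symmetric])
        (use f' has_derivative_linear in blast)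
    then show "((\<lambda>x. f (g x)) has_derivative ?D x) (at x)"
      using diff_chain_at[OF diffk_SucD(1)[OF Suc.prems(1) x] f'] by (simp add: o_def)
  next
    fix v
    have "diffk k U (\<lambda>x. frechet_derivative g (at x) v \<bullet> b)" for b
      by (rule diffk_bilinear[OF bounded_bilinear_inner assms(1) diffk_SucD(2)[OF Suc.prems(1)]
            diffk_const[OF assms(1)]])
    then show "diffk k U (\<lambda>x. ?D x v)"
      by (intro diffk_sum assms(1) diffk_bilinear[OF bounded_bilinear_scaleR] Suc.IH[OF g]
          diffk_SucD(2)[OF Suc.prems(2)])
  qed
qed

section \<open>The radial retraction and extensions constant along rays\<close>

text \<open>The derivative in direction \<open>v\<close> is minus the inner product of
  \<open>x\<close> and \<open>v\<close>, divided by the cube of the norm: three copies of the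
  function itself times a linear function, so the induction closes.\<close>

lemma diffk_inverse_norm: "diffk k (- {0}) (\<lambda>x::'a::euclidean_space. inverse (norm x))"
proof (induction k)
  case 0
  show ?case by (auto simp: diffk_0 intro!: derivative_intros differentiable_norm_at differentiable_inverse)
next
  case (Suc k)
  let ?i = "\<lambda>x::'a. inverse (norm x)"
  let ?D = "\<lambda>(x::'a) v. (?i x * ?i x * ?i x) * (x \<bullet> - v)"
  show ?case
  proof (rule diffk_SucI[where D = ?D])
    fix x :: 'a assume "x \<in> - {0}"
    then show "(?i has_derivative ?D x) (at x)"
      by (auto intro!: derivative_eq_intros has_derivative_norm simp: sgn_div_norm divide_simps inner_commute)
  next
    fix v :: 'a
    have "diffk k (- {0}) (\<lambda>x. x \<bullet> - v)"
      by (rule diffk_linear) (auto intro: bounded_linear_minus bounded_linear_inner_left)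
    then show "diffk k (- {0}) (\<lambda>x. ?D x v)"
      by (intro diffk_bilinear[OF bounded_bilinear_mult] Suc) auto
  qed auto
qed

lemma diffk_sgn: "diffk k (- {0}) (sgn :: 'a::euclidean_space \<Rightarrow> 'a)"
proof -
  have "diffk k (- {0}) (\<lambda>x::'a. inverse (norm x) *\<^sub>R x)"
    by (intro diffk_bilinear[OF bounded_bilinear_scaleR] diffk_inverse_norm diffk_linear) auto
  then show ?thesis by (rule diffk_cong[rotated 2]) (auto simp: sgn_div_norm)
qed

text \<open>Near \<open>x\<close> the map is a local smooth extension \<open>F\<close> of
  \<open>s\<close> precomposed with \<open>sgn\<close>, on the open preimage \<open>V\<close> of the
  domain of \<open>F\<close>.\<close>

lemma smooth_on_open_comp_sgn:
  fixes s :: "'a::euclidean_space \<Rightarrow> 'a"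
  assumes "smooth_map_on (sphere 0 1) s"
  shows "smooth_on_open (- {0}) (s \<circ> sgn)"
  unfolding smooth_on_open_def
proof (intro conjI allI ballI)
  fix vs :: "'a list" and x :: 'a assume x: "x \<in> - {0}"
  then have "sgn x \<in> sphere 0 1" by (simp add: norm_sgn)
  then obtain U F where U: "sgn x \<in> U" "smooth_on_open U F" "\<forall>y\<in>sphere 0 1 \<inter> U. F y = s y"
    using assms unfolding smooth_map_on_def by blast
  define V where "V = {y \<in> - {0}. sgn y \<in> U}"
  have "continuous_on (- {0}) (sgn :: 'a \<Rightarrow> 'a)" by (intro continuous_intros) auto
  then have "open (- {0} \<inter> sgn -` U)"
    using U(2) by (intro continuous_open_preimage) (auto simp: smooth_on_open_def)
  also have "- {0} \<inter> sgn -` U = V" by (auto simp: V_def)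
  finally have V: "open V" .
  have "diffk (length vs) V (\<lambda>y. F (sgn y))"
  proof (rule diffk_compose[OF V, where V = U and g = sgn and f = F])
    show "diffk (length vs) V (sgn :: 'a \<Rightarrow> 'a)"
      by (rule diffk_subset[OF diffk_sgn]) (auto simp: V_def)
  qed (use U(2) in \<open>auto simp: V_def smooth_on_open_iff\<close>)
  then have "diffk (length vs) V (s \<circ> sgn)"
    by (rule diffk_cong[OF V, rotated]) (use U(3) in \<open>auto simp: V_def norm_sgn\<close>)
  then show "dir_derivs vs (s \<circ> sgn) differentiable at x"
    using x U(1) unfolding diffk_def V_def by auto
qed auto

lemma smooth_map_on_bounded_linear:
  fixes f :: "'a::euclidean_space \<Rightarrow> 'b::euclidean_space"
  assumes "bounded_linear f" "\<And>x. x \<in> S \<Longrightarrow> s x = f x"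
  shows "smooth_map_on S s"
  unfolding smooth_map_on_def
  by (intro ballI exI[of _ UNIV] exI[of _ f]) (use assms in \<open>auto simp: smooth_on_open_iff diffk_linear\<close>)

section \<open>Symmetry of second derivatives\<close>

text \<open>The mean value theorem is applied twice to the second difference over a parallelogram:
  first along \<open>u\<close>, then along \<open>v\<close> to the derivative in direction
  \<open>u\<close>.\<close>

lemma mixed_difference:
  fixes f :: "'a::real_normed_vector \<Rightarrow> real"
  assumes f: "\<And>y. y \<in> U \<Longrightarrow> (f has_derivative D y) (at y)"
    and Du: "\<And>y. y \<in> U \<Longrightarrow> ((\<lambda>y. D y u) has_derivative E y) (at y)"
    and h: "0 < h" and U: "\<And>a b. a \<in> {0..h} \<Longrightarrow> b \<in> {0..h} \<Longrightarrow> x + a *\<^sub>R u + b *\<^sub>R v \<in> U"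
  obtains a b where "a \<in> {0..h}" "b \<in> {0..h}"
    "f (x + h *\<^sub>R u + h *\<^sub>R v) - f (x + h *\<^sub>R u) - f (x + h *\<^sub>R v) + f x
      = h * h * E (x + a *\<^sub>R u + b *\<^sub>R v) v"
proof -
  let ?p = "\<lambda>a b. x + a *\<^sub>R u + b *\<^sub>R v"
  let ?F = "\<lambda>a. f (?p a h) - f (?p a 0)"
  have fd: "((\<lambda>a. f (?p a b)) has_derivative (\<lambda>t. D (?p a b) (t *\<^sub>R u))) (at a)"
    if "a \<in> {0..h}" "b \<in> {0..h}" for a b
    by (rule has_derivative_compose[where g = f and f = "\<lambda>a. ?p a b", OF _ f[OF U[OF that]]]) (auto intro!: derivative_eq_intros)
  have lin: "D (?p a b) (t *\<^sub>R u) = t * D (?p a b) u" if "a \<in> {0..h}" "b \<in> {0..h}" for a b t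
    using linear_scale[OF has_derivative_linear[OF f[OF U[OF that]]], of t u] by simp
  have "(?F has_real_derivative (D (?p a h) u - D (?p a 0) u)) (at a)" if "a \<in> {0..h}" for a
  proof -
    have I: "h \<in> {0..h}" "0 \<in> {0..h}" using h by auto
    have "(?F has_derivative (\<lambda>t. D (?p a h) (t *\<^sub>R u) - D (?p a 0) (t *\<^sub>R u))) (at a)"
      by (intro has_derivative_diff fd that I)
    then show ?thesis
      unfolding has_field_derivative_def lin[OF that I(1)] lin[OF that I(2)]
      by (rule has_derivative_eq_rhs) (simp add: fun_eq_iff right_diff_distrib mult.commute)
  qed
  then obtain a where a: "0 < a" "a < h" "?F h - ?F 0 = (h - 0) * (D (?p a h) u - D (?p a 0) u)"
    using MVT2[OF h, of ?F "\<lambda>a. D (?p a h) u - D (?p a 0) u"] by auto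
  have aI: "a \<in> {0..h}" using a by auto
  have "((\<lambda>b. D (?p a b) u) has_real_derivative E (?p a b) v) (at b)" if "b \<in> {0..h}" for b
  proof -
    have "((\<lambda>b. D (?p a b) u) has_derivative (\<lambda>t. E (?p a b) (t *\<^sub>R v))) (at b)"
      by (rule has_derivative_compose[where g = "\<lambda>y. D y u" and f = "?p a", OF _ Du[OF U[OF aI that]]]) (auto intro!: derivative_eq_intros)
    moreover have "E (?p a b) (t *\<^sub>R v) = E (?p a b) v * t" for t
      using linear_scale[OF has_derivative_linear[OF Du[OF U[OF aI that]]], of t v] by simp
    ultimately show ?thesis by (simp add: has_field_derivative_def mult_commute_abs)
  qed
  then obtain b where b: "0 < b" "b < h" "D (?p a h) u - D (?p a 0) u = (h - 0) * E (?p a b) v"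
    using MVT2[OF h, of "\<lambda>b. D (?p a b) u" "\<lambda>b. E (?p a b) v"] by auto
  show ?thesis
    by (rule that[OF aI, of b]) (use a b in \<open>auto simp: algebra_simps\<close>)
qed

text \<open>The second difference is symmetric in \<open>u\<close> and \<open>v\<close>, so the two
  mixed derivatives take equal values at points arbitrarily close to \<open>x\<close>; continuity
  makes them agree at \<open>x\<close>.\<close>

lemma symmetric_mixed_derivatives_real:
  fixes f :: "'a::real_normed_vector \<Rightarrow> real"
  assumes "open U" "x \<in> U"
    and f: "\<And>y. y \<in> U \<Longrightarrow> (f has_derivative D y) (at y)"
    and Du: "\<And>y. y \<in> U \<Longrightarrow> ((\<lambda>y. D y u) has_derivative E y) (at y)"
    and Dv: "\<And>y. y \<in> U \<Longrightarrow> ((\<lambda>y. D y v) has_derivative G y) (at y)"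
    and cont: "isCont (\<lambda>y. E y v) x" "isCont (\<lambda>y. G y u) x"
  shows "E x v = G x u"
proof (rule ccontr)
  assume neq: "E x v \<noteq> G x u"
  define e where "e = \<bar>E x v - G x u\<bar> / 2"
  have e: "e > 0" using neq by (simp add: e_def)
  obtain d1 where d1: "d1 > 0" "\<And>y. dist y x < d1 \<Longrightarrow> dist (E y v) (E x v) < e"
    using cont(1) e unfolding continuous_at_eps_delta by blast
  obtain d2 where d2: "d2 > 0" "\<And>y. dist y x < d2 \<Longrightarrow> dist (G y u) (G x u) < e"
    using cont(2) e unfolding continuous_at_eps_delta by blast
  obtain d3 where d3: "d3 > 0" "\<And>y. dist y x < d3 \<Longrightarrow> y \<in> U"
    using assms(1,2) unfolding open_dist by blast
  define d where "d = min d1 (min d2 d3)"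
  have d: "d > 0" using d1 d2 d3 by (simp add: d_def)
  \<comment> \<open>This keeps the whole parallelogram within distance \<open>d / 2\<close> of
    \<open>x\<close>; the summand 1 makes the denominator positive even for
    \<open>u = v = 0\<close>.\<close>
  define h where "h = (d / 2) / (norm u + norm v + 1)"
  have nn: "norm u + norm v + 1 > 0" by (simp add: add_nonneg_pos)
  then have h: "h > 0" using d by (simp add: h_def)
  have near: "dist (x + a *\<^sub>R u + b *\<^sub>R v) x < d" if "a \<in> {0..h}" "b \<in> {0..h}" for a b
  proof -
    have "dist (x + a *\<^sub>R u + b *\<^sub>R v) x = norm (a *\<^sub>R u + b *\<^sub>R v)"
      by (simp add: dist_norm algebra_simps)
    also have "\<dots> \<le> a * norm u + b * norm v"
      using that norm_triangle_ineq[of "a *\<^sub>R u" "b *\<^sub>R v"] by simp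
    also have "\<dots> \<le> h * norm u + h * norm v"
      using that by (intro add_mono mult_right_mono) auto
    also have "\<dots> \<le> h * (norm u + norm v + 1)"
      using h by (simp add: algebra_simps)
    also have "\<dots> = d / 2"
      unfolding h_def by (rule nonzero_eq_divide_eq[THEN iffD1, OF _ refl]) (use nn in linarith)
    also have "\<dots> < d" using d by simp
    finally show ?thesis .
  qed
  obtain a b where ab: "a \<in> {0..h}" "b \<in> {0..h}"
    "f (x + h *\<^sub>R u + h *\<^sub>R v) - f (x + h *\<^sub>R u) - f (x + h *\<^sub>R v) + f x
      = h * h * E (x + a *\<^sub>R u + b *\<^sub>R v) v"
  proof (rule mixed_difference[of U f D u E h x v])
    show "x + a *\<^sub>R u + b *\<^sub>R v \<in> U" if "a \<in> {0..h}" "b \<in> {0..h}" for a b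
      using near[OF that] d3(2) unfolding d_def by simp
  qed (use f Du h in auto)
  obtain a' b' where ab': "a' \<in> {0..h}" "b' \<in> {0..h}"
    "f (x + h *\<^sub>R v + h *\<^sub>R u) - f (x + h *\<^sub>R v) - f (x + h *\<^sub>R u) + f x
      = h * h * G (x + a' *\<^sub>R v + b' *\<^sub>R u) u"
  proof (rule mixed_difference[of U f D v G h x u])
    show "x + a *\<^sub>R v + b *\<^sub>R u \<in> U" if "a \<in> {0..h}" "b \<in> {0..h}" for a b
      using near[OF that(2,1)] d3(2) unfolding d_def by (simp add: algebra_simps)
  qed (use f Dv h in auto)
  have sw: "x + h *\<^sub>R v + h *\<^sub>R u = x + h *\<^sub>R u + h *\<^sub>R v"
    "x + a' *\<^sub>R v + b' *\<^sub>R u = x + b' *\<^sub>R u + a' *\<^sub>R v" by (simp_all add: algebra_simps)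
  have "h * h * E (x + a *\<^sub>R u + b *\<^sub>R v) v = h * h * G (x + b' *\<^sub>R u + a' *\<^sub>R v) u"
    using ab(3) ab'(3) unfolding sw by linarith
  then have "E (x + a *\<^sub>R u + b *\<^sub>R v) v = G (x + b' *\<^sub>R u + a' *\<^sub>R v) u" using h by simp
  moreover have "dist (E (x + a *\<^sub>R u + b *\<^sub>R v) v) (E x v) < e"
    using d1(2) near[OF ab(1,2)] unfolding d_def by simp
  moreover have "dist (G (x + b' *\<^sub>R u + a' *\<^sub>R v) u) (G x u) < e"
    using d2(2) near[OF ab'(2,1)] unfolding d_def by simp
  ultimately show False unfolding e_def dist_real_def by (simp add: abs_if split: if_splits)
qed

text \<open>The real case is applied to each coordinate; second derivatives of a smooth map are
  continuous because they are differentiable again.\<close>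

lemma dir_derivs_commute:
  fixes f :: "'a::euclidean_space \<Rightarrow> 'b::euclidean_space"
  assumes f: "smooth_on_open U f" and x: "x \<in> U"
  shows "dir_derivs [u, v] f x = dir_derivs [v, u] f x"
proof (rule euclidean_eqI)
  fix b :: 'b assume "b \<in> Basis"
  have hd: "(dir_derivs vs f has_derivative frechet_derivative (dir_derivs vs f) (at y)) (at y)"
    if "y \<in> U" for y vs
    using f that by (simp add: smooth_on_open_def frechet_derivative_works)
  have U: "open U" using f by (simp add: smooth_on_open_def)
  have hb: "((\<lambda>y. dir_derivs vs f y \<bullet> b) has_derivative
      (\<lambda>w. frechet_derivative (dir_derivs vs f) (at y) w \<bullet> b)) (at y)" if "y \<in> U" for y vs
    by (rule has_derivative_inner_left[OF hd[OF that]])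
  have c: "isCont (\<lambda>y. frechet_derivative (dir_derivs [w] f) (at y) w' \<bullet> b) x" for w w'
    using has_derivative_continuous[OF hb[OF x, of "[w', w]"]] by simp
  show "dir_derivs [u, v] f x \<bullet> b = dir_derivs [v, u] f x \<bullet> b"
    using symmetric_mixed_derivatives_real[OF U x, of "\<lambda>y. f y \<bullet> b"
        "\<lambda>y w. frechet_derivative f (at y) w \<bullet> b" v
        "\<lambda>y w. frechet_derivative (dir_derivs [v] f) (at y) w \<bullet> b" u
        "\<lambda>y w. frechet_derivative (dir_derivs [u] f) (at y) w \<bullet> b"]
      hb[of _ "[]"] hb[of _ "[u]"] hb[of _ "[v]"] c
    by simp
qed

section \<open>Differentials of contactomorphisms\<close>

lemma linear_vector_smult: "linear (\<lambda>v::complex ^ 'n. c *s v)"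
  by (rule linearI) (simp_all add: vec_eq_iff algebra_simps)

lemma bounded_linear_vector_smult: "bounded_linear (\<lambda>v::complex ^ 'n. c *s v)"
  using linear_vector_smult linear_conv_bounded_linear by blast

lemma bounded_bilinear_alpha0: "bounded_bilinear (alpha0 :: complex ^ 'n \<Rightarrow> _)"
proof -
  have "linear (alpha0 x)" for x :: "complex ^ 'n"
    unfolding alpha0_eq_inner[abs_def] by (simp add: bounded_linear_inner_right bounded_linear.linear)
  then show ?thesis
    unfolding bilinear_conv_bounded_bilinear[symmetric] bilinear_def using linear_alpha0_left by blast
qed

lemma inner_i_i: "(\<i> *s u) \<bullet> (\<i> *s w) = u \<bullet> (w :: complex ^ 'n)"
  by (simp add: inner_vec_def inner_complex_def algebra_simps)

lemma inner_i_right: "u \<bullet> (\<i> *s w) = - alpha0 u (w :: complex ^ 'n)"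
  by (simp add: alpha0_def inner_vec_def inner_complex_def sum_negf[symmetric] algebra_simps)

lemma i_i: "\<i> *s (\<i> *s u) = - (u :: complex ^ 'n)"
  by (simp add: vec_eq_iff)

lemma alpha0_i_right: "alpha0 u (\<i> *s w) = u \<bullet> (w :: complex ^ 'n)"
  by (simp add: alpha0_eq_inner inner_i_i)

lemma alpha0_self: "alpha0 u (u :: complex ^ 'n) = 0"
  using alpha0_antisym[of u u] by simp

lemma mem_xi0: "v \<in> xi0 z \<longleftrightarrow> z \<bullet> v = 0 \<and> alpha0 z v = 0"
  by (simp add: xi0_def sphere_tangent_def)

lemma xi0_i: "v \<in> xi0 z \<Longrightarrow> \<i> *s v \<in> xi0 z"
  by (simp add: mem_xi0 alpha0_i_right inner_i_right)

lemma subspace_xi0: "subspace (xi0 z)"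
  by (auto simp: subspace_def mem_xi0 inner_add_right bounded_bilinear.add_right[OF bounded_bilinear_alpha0]
      bounded_bilinear.scaleR_right[OF bounded_bilinear_alpha0] bounded_bilinear.zero_right[OF bounded_bilinear_alpha0])

text \<open>\<open>z\<close> and \<open>\<i> *s z\<close> are orthonormal for the real inner
  product, and \<open>xi0 z\<close> is the orthogonal complement of their span. Since
  \<open>alpha0 z v\<close> is the component of \<open>v\<close> along \<open>\<i> *s z\<close>,
  this vector is the orthogonal projection of \<open>v\<close>.\<close>

lemma xi0_decomposition:
  assumes "z \<in> sphere 0 1"
  shows "v - (z \<bullet> v) *\<^sub>R z - alpha0 z v *\<^sub>R (\<i> *s z) \<in> xi0 z"
proof -
  have "z \<bullet> z = 1" using assms by (simp add: dot_square_norm)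
  then show ?thesis
    by (simp add: mem_xi0 inner_diff_right inner_i_right alpha0_self alpha0_i_right
        bounded_bilinear.diff_right[OF bounded_bilinear_alpha0]
        bounded_bilinear.scaleR_right[OF bounded_bilinear_alpha0])
qed

lemma sgn_has_derivative_sphere:
  assumes "z \<in> sphere 0 (1::real)"
  shows "((sgn :: 'a::euclidean_space \<Rightarrow> 'a) has_derivative (\<lambda>v. v - (z \<bullet> v) *\<^sub>R z)) (at z)"
proof -
  have n: "norm z = 1" "z \<noteq> 0" using assms by auto
  have "((\<lambda>x::'a. inverse (norm x) *\<^sub>R x) has_derivative (\<lambda>v. v - (z \<bullet> v) *\<^sub>R z)) (at z)"
    by (auto intro!: derivative_eq_intros has_derivative_norm simp: n sgn_div_norm inner_commute)
  then show ?thesis by (simp add: sgn_div_norm[abs_def])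
qed

section \<open>Differentials of diffeomorphisms of the sphere\<close>

context
  fixes s :: "'a::euclidean_space \<Rightarrow> 'a"
  assumes s: "s \<in> diffeos (sphere 0 1)"
begin

lemma diffeo_maps_sphere: "z \<in> sphere 0 1 \<Longrightarrow> s z \<in> sphere 0 1"
  using s unfolding diffeos_def bij_betw_def by blast

lemma diffeo_smooth: "smooth_on_open (- {0}) (s \<circ> sgn)"
  using s by (auto simp: diffeos_def intro: smooth_on_open_comp_sgn)

lemma diffeo_has_derivative:
  "z \<noteq> 0 \<Longrightarrow> ((s \<circ> sgn) has_derivative sphere_differential s z) (at z)"
  using diffeo_smooth unfolding smooth_on_open_iff sphere_differential_def
  by (metis Compl_iff diffk_0 frechet_derivative_works singletonD)

lemma linear_sphere_differential: "z \<noteq> 0 \<Longrightarrow> linear (sphere_differential s z)"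
  using diffeo_has_derivative has_derivative_linear by blast

text \<open>The extension \<open>s \<circ> sgn\<close> is invariant under positive scaling, so its
  derivative is homogeneous of degree -1.\<close>

lemma sphere_differential_sgn:
  assumes "z \<noteq> 0"
  shows "norm z *\<^sub>R sphere_differential s z w = sphere_differential s (sgn z) w"
proof -
  have "((\<lambda>x. norm z *\<^sub>R x) has_derivative (\<lambda>x. norm z *\<^sub>R x)) (at (sgn z))"
    by (intro derivative_eq_intros) auto
  moreover have "norm z *\<^sub>R sgn z = z" using assms by (simp add: sgn_div_norm)
  ultimately have "((s \<circ> sgn \<circ> (\<lambda>x. norm z *\<^sub>R x)) has_derivative
      sphere_differential s z \<circ> (\<lambda>x. norm z *\<^sub>R x)) (at (sgn z))"
    using diff_chain_at diffeo_has_derivative[OF assms] by metis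
  moreover have "s \<circ> sgn \<circ> (\<lambda>x. norm z *\<^sub>R x) = s \<circ> sgn"
    using assms by (simp add: fun_eq_iff sgn_scaleR)
  moreover have "sgn z \<noteq> 0" using assms by (simp add: sgn_zero_iff)
  ultimately have "sphere_differential s z \<circ> (\<lambda>x. norm z *\<^sub>R x) = sphere_differential s (sgn z)"
    using has_derivative_unique diffeo_has_derivative by metis
  then show ?thesis
    using linear_scale[OF linear_sphere_differential[OF assms]] by (metis comp_apply)
qed

text \<open>\<open>sgn\<close> is idempotent, so precomposing the extension with \<open>sgn\<close>,
  whose derivative at \<open>z\<close> is the orthogonal projection, changes nothing. In particular
  the differential kills \<open>z\<close>.\<close>

lemma sphere_differential_proj:
  assumes z: "z \<in> sphere 0 1"
  shows "sphere_differential s z (v - (z \<bullet> v) *\<^sub>R z) = sphere_differential s z v"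
proof -
  have z0: "z \<noteq> 0" and sz: "sgn z = z" using z by (auto simp: sgn_div_norm)
  have "((s \<circ> sgn \<circ> sgn) has_derivative sphere_differential s z \<circ> (\<lambda>v. v - (z \<bullet> v) *\<^sub>R z)) (at z)"
    using diff_chain_at[OF sgn_has_derivative_sphere[OF z], of "s \<circ> sgn" "sphere_differential s z"]
      diffeo_has_derivative[OF z0] by (simp add: sz)
  moreover have "sgn (sgn x) = sgn x" for x :: 'a
    by (cases "x = 0") (simp_all add: sgn_div_norm)
  then have "s \<circ> sgn \<circ> sgn = s \<circ> sgn" by (auto simp: fun_eq_iff)
  ultimately have "sphere_differential s z \<circ> (\<lambda>v. v - (z \<bullet> v) *\<^sub>R z) = sphere_differential s z"
    using has_derivative_unique diffeo_has_derivative[OF z0] by metis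
  then show ?thesis by (metis comp_apply)
qed

text \<open>The squared norm of the extension is constantly 1 away from the origin; its derivative
  is twice this inner product.\<close>

lemma sphere_differential_tangent:
  assumes z: "z \<in> sphere 0 1"
  shows "s z \<bullet> sphere_differential s z v = 0"
proof -
  have z0: "z \<noteq> 0" and sz: "sgn z = z" using z by (auto simp: sgn_div_norm)
  let ?S = "s \<circ> sgn" and ?D = "sphere_differential s z"
  have "((\<lambda>x. ?S x \<bullet> ?S x) has_derivative (\<lambda>v. ?S z \<bullet> ?D v + ?D v \<bullet> ?S z)) (at z)"
    by (rule has_derivative_inner[OF diffeo_has_derivative[OF z0] diffeo_has_derivative[OF z0]])
  moreover have "((\<lambda>x. ?S x \<bullet> ?S x) has_derivative (\<lambda>v. 0)) (at z)"
  proof (rule has_derivative_transform_within_open[OF has_derivative_const[of "1::real"]])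
    show "1 = ?S x \<bullet> ?S x" if "x \<in> - {0}" for x
      using diffeo_maps_sphere[of "sgn x"] that by (simp add: norm_sgn dot_square_norm)
  qed (use z0 in auto)
  ultimately have "(\<lambda>v. ?S z \<bullet> ?D v + ?D v \<bullet> ?S z) = (\<lambda>v. 0)"
    using has_derivative_unique by blast
  then have "?S z \<bullet> ?D v + ?D v \<bullet> ?S z = 0" by meson
  then show ?thesis by (simp add: sz inner_commute)
qed

text \<open>Composing the extension of the inverse map with that of \<open>s\<close> gives
  \<open>sgn\<close>, whose derivative is the identity on tangent vectors. The differential
  therefore has a left inverse there.\<close>

lemma sphere_differential_inj:
  assumes z: "z \<in> sphere 0 1" and v: "z \<bullet> v = 0" and eq: "sphere_differential s z v = 0"
  shows "v = 0"
proof -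
  have z0: "z \<noteq> 0" and sz: "sgn z = z" using z by (auto simp: sgn_div_norm)
  let ?T = "inv_into (sphere 0 1) s \<circ> sgn"
  have S: "s z \<noteq> 0" using diffeo_maps_sphere[OF z] by auto
  have "smooth_on_open (- {0}) ?T"
    using s by (auto simp: diffeos_def intro: smooth_on_open_comp_sgn)
  then obtain E where E: "(?T has_derivative E) (at (s z))"
    using S unfolding smooth_on_open_iff by (metis Compl_iff diffk_0 differentiable_def singletonD)
  have "((?T \<circ> (s \<circ> sgn)) has_derivative E \<circ> sphere_differential s z) (at z)"
    using diff_chain_at[OF diffeo_has_derivative[OF z0], of ?T E] E by (simp add: sz)
  moreover have "(?T \<circ> (s \<circ> sgn)) x = sgn x" if "x \<in> - {0}" for x
  proof -
    have x: "sgn x \<in> sphere 0 1" using that by (simp add: norm_sgn)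
    then have "sgn (s (sgn x)) = s (sgn x)"
      using diffeo_maps_sphere[OF x] by (simp add: sgn_div_norm)
    then show ?thesis
      using x s by (auto simp: diffeos_def bij_betw_def)
  qed
  ultimately have "(sgn has_derivative E \<circ> sphere_differential s z) (at z)"
    using has_derivative_transform_within_open[of "?T \<circ> (s \<circ> sgn)" _ z UNIV "- {0}" sgn] z0 by auto
  then have "E \<circ> sphere_differential s z = (\<lambda>v. v - (z \<bullet> v) *\<^sub>R z)"
    using has_derivative_unique sgn_has_derivative_sphere[OF z] by blast
  then have "E (sphere_differential s z v) = v - (z \<bullet> v) *\<^sub>R z" by (metis comp_apply)
  then show ?thesis
    using eq v linear_0[OF has_derivative_linear[OF E]] by simp
qed

end

section \<open>The action of contactomorphisms on the contact form\<close>

text \<open>For a contactomorphism this is the function by which the pullback of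
  \<open>alpha0\<close> differs from \<open>alpha0\<close>, read off at the Reeb vector
  \<open>\<i> *s z\<close>.\<close>

definition conformal_factor :: "(complex ^ 'n \<Rightarrow> complex ^ 'n) \<Rightarrow> complex ^ 'n \<Rightarrow> real"
  where "conformal_factor s z = alpha0 (s z) (sphere_differential s z (\<i> *s z))"

context
  fixes s :: "complex ^ 'n \<Rightarrow> complex ^ 'n"
  assumes s: "s \<in> contactomorphisms"
begin

lemma contacto_diffeo: "s \<in> diffeos (sphere 0 1)"
  using s by (simp add: contactomorphisms_def)

lemma contacto_xi0: "z \<in> sphere 0 1 \<Longrightarrow> sphere_differential s z ` xi0 z = xi0 (s z)"
  using s by (simp add: contactomorphisms_def)

text \<open>Modulo \<open>z\<close>, which the differential kills, \<open>v\<close> is a vector of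
  \<open>xi0 z\<close> plus \<open>alpha0 z v\<close> times the Reeb vector. The former is mapped
  into \<open>xi0 (s z)\<close>, so only the Reeb component contributes.\<close>

lemma contacto_pullback:
  assumes z: "z \<in> sphere 0 1"
  shows "alpha0 (s z) (sphere_differential s z v) = conformal_factor s z * alpha0 z v"
proof -
  let ?D = "sphere_differential s z" and ?u = "v - (z \<bullet> v) *\<^sub>R z - alpha0 z v *\<^sub>R (\<i> *s z)"
  have lin: "linear ?D" by (rule linear_sphere_differential[OF contacto_diffeo]) (use z in auto)
  have "?D v = ?D (?u + alpha0 z v *\<^sub>R (\<i> *s z))"
    using sphere_differential_proj[OF contacto_diffeo z, of v] by simp
  also have "\<dots> = ?D ?u + alpha0 z v *\<^sub>R ?D (\<i> *s z)"
    by (simp only: linear_add[OF lin] linear_scale[OF lin])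
  finally have *: "?D v = ?D ?u + alpha0 z v *\<^sub>R ?D (\<i> *s z)" .
  have "?D ?u \<in> xi0 (s z)" using contacto_xi0[OF z] xi0_decomposition[OF z] by blast
  then have "alpha0 (s z) (?D ?u) = 0" by (simp add: mem_xi0)
  then show ?thesis
    unfolding * conformal_factor_def bounded_bilinear.add_right[OF bounded_bilinear_alpha0]
      bounded_bilinear.scaleR_right[OF bounded_bilinear_alpha0] by simp
qed

text \<open>Otherwise the Reeb vector would be mapped into \<open>xi0 (s z)\<close>, which is
  already the image of \<open>xi0 z\<close>; injectivity on tangent vectors would then put the Reeb
  vector into \<open>xi0 z\<close>.\<close>

lemma conformal_factor_nonzero:
  assumes z: "z \<in> sphere 0 1"
  shows "conformal_factor s z \<noteq> 0"
proof
  assume 0: "conformal_factor s z = 0"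
  let ?D = "sphere_differential s z"
  have lin: "linear ?D" by (rule linear_sphere_differential[OF contacto_diffeo]) (use z in auto)
  have "?D (\<i> *s z) \<in> xi0 (s z)"
    using 0 sphere_differential_tangent[OF contacto_diffeo z] by (simp add: mem_xi0 conformal_factor_def)
  then obtain u where u: "u \<in> xi0 z" "?D u = ?D (\<i> *s z)"
    using contacto_xi0[OF z] by (metis imageE)
  have "?D (\<i> *s z - u) = 0" using u by (simp add: linear_diff[OF lin])
  moreover have "z \<bullet> (\<i> *s z - u) = 0"
    using u by (simp add: inner_diff_right inner_i_right alpha0_self mem_xi0)
  ultimately have "\<i> *s z - u = 0"
    using sphere_differential_inj[OF contacto_diffeo z] by blast
  then have "alpha0 z (\<i> *s z) = 0" using u by (simp add: mem_xi0)
  then show False using z by (simp add: alpha0_i_right)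
qed

text \<open>The pullback of \<open>\<alpha>\<^sub>0\<close> is proportional to \<open>\<alpha>\<^sub>0\<close>. Differentiating this proportionality and
  antisymmetrising removes the second derivatives of \<open>s\<close>; the terms with the derivative of the
  proportionality factor vanish on \<open>\<xi>\<^sub>0\<close>.\<close>

lemma contacto_conformally_symplectic:
  assumes z: "z \<in> sphere 0 1" and u: "u \<in> xi0 z" and v: "v \<in> xi0 z"
  shows "alpha0 (sphere_differential s z u) (sphere_differential s z v) = conformal_factor s z * alpha0 u v"
proof -
  let ?S = "s \<circ> sgn" and ?D = "sphere_differential s"
  let ?b = "\<lambda>w y. alpha0 (?S y) (?D y w)"
  let ?R = "\<i> *s z"
  have z0: "z \<noteq> 0" and sz: "sgn z = z" using z by (auto simp: sgn_div_norm)
  note bb = bounded_bilinear_alpha0[where 'n = 'n]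
  \<comment> \<open>Cross-multiplying eliminates the conformal factor and leaves an identity on the
    open set \<open>y \<noteq> 0\<close> whose two sides can be differentiated directly.\<close>
  have proportional: "?b w y * alpha0 y w' = ?b w' y * alpha0 y w" if "y \<noteq> 0" for w w' y
  proof -
    have y: "sgn y \<in> sphere 0 1" using that by (simp add: norm_sgn)
    have a: "alpha0 y w = norm y * alpha0 (sgn y) w" for w
      using bounded_bilinear.scaleR_left[OF bb, of "norm y" "sgn y" w] that by (simp add: sgn_div_norm)
    have "norm y * ?b w y = alpha0 (s (sgn y)) (norm y *\<^sub>R ?D y w)" for w
      by (simp add: bounded_bilinear.scaleR_right[OF bb])
    then have b: "norm y * ?b w y = conformal_factor s (sgn y) * alpha0 (sgn y) w" for w
      using contacto_pullback[OF y] sphere_differential_sgn[OF contacto_diffeo that] by simp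
    have "?b w y * alpha0 y w' = (norm y * ?b w y) * alpha0 (sgn y) w'"
      "?b w' y * alpha0 y w = (norm y * ?b w' y) * alpha0 (sgn y) w"
      unfolding a[of w] a[of w'] by simp_all
    then show ?thesis unfolding b by simp
  qed
  have dd: "((\<lambda>y. ?D y w) has_derivative (\<lambda>x. dir_derivs [x, w] ?S z)) (at z)" for w
  proof -
    have "dir_derivs [w] ?S differentiable (at z)"
      using diffeo_smooth[OF contacto_diffeo] z0 unfolding smooth_on_open_def by blast
    then show ?thesis
      by (simp add: sphere_differential_def frechet_derivative_works)
  qed
  have db: "(?b w has_derivative (\<lambda>x. alpha0 (s z) (dir_derivs [x, w] ?S z) + alpha0 (?D z x) (?D z w))) (at z)" for w
    using bounded_bilinear.FDERIV[OF bb diffeo_has_derivative[OF contacto_diffeo z0] dd[of w]]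
    by (simp add: sz)
  have da: "((\<lambda>y. alpha0 y w) has_derivative (\<lambda>x. alpha0 x w)) (at z)" for w
    using linear_alpha0_left linear_imp_has_derivative by blast
  have key: "alpha0 (s z) (dir_derivs [x, w] ?S z) + alpha0 (?D z x) (?D z w)
      = conformal_factor s z * alpha0 x w" if w: "w \<in> xi0 z" for x w
  proof -
    have "((\<lambda>y. ?b w y * alpha0 y ?R) has_derivative (\<lambda>x. ?b w z * alpha0 x ?R
        + (alpha0 (s z) (dir_derivs [x, w] ?S z) + alpha0 (?D z x) (?D z w)) * alpha0 z ?R)) (at z)"
      by (rule has_derivative_mult[OF db da])
    then have 1: "((\<lambda>y. ?b ?R y * alpha0 y w) has_derivative (\<lambda>x. ?b w z * alpha0 x ?R
        + (alpha0 (s z) (dir_derivs [x, w] ?S z) + alpha0 (?D z x) (?D z w)) * alpha0 z ?R)) (at z)"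
    proof (rule has_derivative_transform_within_open)
      show "?b w y * alpha0 y ?R = ?b ?R y * alpha0 y w" if "y \<in> - {0}" for y
        using that by (intro proportional) simp
    qed (use z0 in auto)
    have 2: "((\<lambda>y. ?b ?R y * alpha0 y w) has_derivative (\<lambda>x. ?b ?R z * alpha0 x w
        + (alpha0 (s z) (dir_derivs [x, ?R] ?S z) + alpha0 (?D z x) (?D z ?R)) * alpha0 z w)) (at z)"
      by (rule has_derivative_mult[OF db da])
    have zz: "alpha0 z ?R = 1" using z by (simp add: alpha0_i_right dot_square_norm)
    \<comment> \<open>These two values are the coefficients of the unwanted terms in the derivatives
      \<open>1\<close> and \<open>2\<close>.\<close>
    have "alpha0 z w = 0" "?b w z = 0"
      using w contacto_pullback[OF z, of w] by (simp_all add: mem_xi0 sz)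
    then show ?thesis
      using fun_cong[OF has_derivative_unique[OF 1 2], of x] by (simp add: zz sz conformal_factor_def)
  qed
  have "dir_derivs [u, v] ?S z = dir_derivs [v, u] ?S z"
    by (rule dir_derivs_commute[OF diffeo_smooth[OF contacto_diffeo]]) (use z0 in auto)
  then show ?thesis
    using key[OF v, of u] key[OF u, of v] alpha0_antisym[of u v] alpha0_antisym[of "?D z u" "?D z v"]
    by (simp add: algebra_simps)
qed

end

section \<open>The determinant of the complex-linear part of the differential\<close>

text \<open>For \<open>j \<noteq> k\<close>, column \<open>j\<close> is the complex-linear part of
  the differential at \<open>axis k 1\<close>, evaluated at \<open>axis j 1\<close>; these basis
  vectors span the contact hyperplane over the complex numbers. Column \<open>k\<close> supplies the
  remaining complex direction by the image point itself.\<close>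

definition jet_matrix :: "'n \<Rightarrow> (complex ^ 'n \<Rightarrow> complex ^ 'n) \<Rightarrow> complex ^ 'n ^ 'n"
  where "jet_matrix k s = (\<chi> i j. if j = k then s (axis k 1) $ i
    else (sphere_differential s (axis k 1) (axis j 1) $ i
      - \<i> * sphere_differential s (axis k 1) (axis j \<i>) $ i) / 2)"

lemma axis_in_sphere: "axis k (1::complex) \<in> sphere 0 1"
proof -
  have "axis k (1::complex) \<bullet> axis k 1 = 1" by (simp add: inner_axis_axis inner_complex_def)
  then show ?thesis by (simp add: norm_eq_sqrt_inner)
qed

lemma i_axis: "\<i> *s axis j 1 = (axis j \<i> :: complex ^ 'n)"
  by (simp add: vec_eq_iff axis_def)

lemma xi0_axis: "v \<in> xi0 (axis k 1) \<longleftrightarrow> v $ k = 0"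
  by (simp add: mem_xi0 alpha0_eq_inner i_axis inner_axis' inner_complex_def complex_eq_iff)

text \<open>A real-linear map is the sum of a complex-linear and a complex-antilinear one, and
  \<open>L v - \<i> *s L (\<i> *s v)\<close> is twice the complex-linear summand.\<close>

lemma complex_part_linear:
  fixes L :: "complex ^ 'n \<Rightarrow> complex ^ 'm"
  assumes "linear L"
  shows "L (c *s v) - \<i> *s L (\<i> *s (c *s v)) = c *s (L v - \<i> *s L (\<i> *s v))"
proof -
  have c: "a *s v = Re a *\<^sub>R v + Im a *\<^sub>R (\<i> *s v)" for a and v :: "complex ^ 'k"
    by (simp add: vec_eq_iff complex_eq_iff)
  have 1: "\<i> *s (c *s v) = - Im c *\<^sub>R v + Re c *\<^sub>R (\<i> *s v)"
    by (simp add: vec_eq_iff complex_eq_iff)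
  have L: "L (a *\<^sub>R x + b *\<^sub>R y) = a *\<^sub>R L x + b *\<^sub>R L y" for a b x y
    by (simp only: linear_add[OF assms] linear_scale[OF assms])
  show ?thesis
    unfolding 1 unfolding c[of c v] L
    by (simp add: vec_eq_iff complex_eq_iff algebra_simps)
qed

text \<open>Here \<open>u\<close> is the component of \<open>v\<close> in the contact hyperplane at
  \<open>axis k 1\<close>. The formula lets the kernel of the matrix be studied through the
  differential instead of its columns.\<close>

lemma jet_matrix_mult:
  fixes k :: "'n::finite" and s :: "complex ^ 'n \<Rightarrow> complex ^ 'n" and v :: "complex ^ 'n"
  assumes s: "s \<in> diffeos (sphere 0 1)"
  defines "D \<equiv> sphere_differential s (axis k 1)" and "u \<equiv> \<chi> j. if j = k then 0 else v $ j"
  shows "jet_matrix k s *v v = (1 / 2) *s (D u - \<i> *s D (\<i> *s u)) + v $ k *s s (axis k 1)"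
proof -
  have lin: "linear D"
    unfolding D_def using linear_sphere_differential[OF s] by (simp add: axis_eq_0_iff)
  define K where "K = (\<lambda>v. D v - \<i> *s D (\<i> *s v))"
  have K0: "K 0 = 0" by (simp add: K_def linear_0[OF lin])
  have Kadd: "K (x + y) = K x + K y" for x y
    by (simp add: K_def linear_add[OF lin] vector_add_ldistrib)
  have Kscale: "K (c *s x) = c *s K x" for c x
    unfolding K_def by (rule complex_part_linear[OF lin])
  have Ksum: "K (sum f I) = (\<Sum>i\<in>I. K (f i))" for f and I :: "'a set"
    by (induction I rule: infinite_finite_induct) (auto simp: K0 Kadd)
  have "K u = K (\<Sum>j\<in>UNIV. u $ j *s axis j 1)" by (simp only: basis_expansion)
  also have "\<dots> = (\<Sum>j\<in>UNIV. u $ j *s K (axis j 1))"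
    unfolding Ksum by (simp only: Kscale)
  finally have Ku: "K u = (\<Sum>j\<in>UNIV. u $ j *s K (axis j 1))" .
  have "(jet_matrix k s *v v) $ i = ((1 / 2) *s K u + v $ k *s s (axis k 1)) $ i" for i
  proof -
    have "(jet_matrix k s *v v) $ i = (\<Sum>j\<in>UNIV. jet_matrix k s $ i $ j * v $ j)"
      by (simp add: matrix_vector_mult_def)
    also have "\<dots> = (\<Sum>j\<in>UNIV. (1 / 2) * (u $ j * K (axis j 1) $ i) + (if j = k then v $ k * s (axis k 1) $ i else 0))"
      by (rule sum.cong) (auto simp: jet_matrix_def u_def K_def D_def i_axis field_simps)
    also have "\<dots> = (1 / 2) * (\<Sum>j\<in>UNIV. u $ j * K (axis j 1) $ i) + v $ k * s (axis k 1) $ i"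
      by (simp add: sum.distrib sum_distrib_left)
    finally show ?thesis by (simp add: Ku)
  qed
  then show ?thesis unfolding K_def by (simp add: vec_eq_iff)
qed

text \<open>On \<open>\<xi>\<^sub>0\<close> the differential \<open>D\<close> scales the symplectic form by a positive factor, so
  \<open>D (i u) = - i D u\<close> would give \<open>d\<alpha>\<^sub>0 (D u) (D (i u))\<close> the wrong sign.\<close>

lemma det_jet_matrix_nonzero:
  assumes s: "s \<in> contactomorphisms" and pos: "conformal_factor s (axis k 1) > 0"
  shows "det (jet_matrix k s) \<noteq> 0"
proof -
  let ?p = "axis k 1" and ?D = "sphere_differential s (axis k 1)"
  note p = axis_in_sphere[of k]
  have "v = 0" if "jet_matrix k s *v v = 0" for v
  proof -
    define u where "u = (\<chi> j. if j = k then 0 else v $ j)"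
    have u: "u \<in> xi0 ?p" by (simp add: xi0_axis u_def)
    define w where "w = (1 / 2) *s (?D u - \<i> *s ?D (\<i> *s u))"
    have w2: "w = (1 / 2) *\<^sub>R (?D u - \<i> *s ?D (\<i> *s u))"
      by (simp add: w_def vec_eq_iff complex_eq_iff)
    have "?D u \<in> xi0 (s ?p)" "?D (\<i> *s u) \<in> xi0 (s ?p)"
      using contacto_xi0[OF s p] u xi0_i[OF u] by blast+
    then have w: "w \<in> xi0 (s ?p)"
      unfolding w2 by (intro subspace_scale[OF subspace_xi0] subspace_diff[OF subspace_xi0] xi0_i)
    have eq: "w + v $ k *s s ?p = 0"
      using that jet_matrix_mult[OF contacto_diffeo[OF s], of k v] by (simp add: w_def u_def)
    have nrm: "s ?p \<bullet> s ?p = 1"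
      using diffeo_maps_sphere[OF contacto_diffeo[OF s] p] by (simp add: dot_square_norm)
    have "v $ k *s s ?p = Re (v $ k) *\<^sub>R s ?p + Im (v $ k) *\<^sub>R (\<i> *s s ?p)"
      by (simp add: vec_eq_iff complex_eq_iff)
    with eq have eq': "w + Re (v $ k) *\<^sub>R s ?p + Im (v $ k) *\<^sub>R (\<i> *s s ?p) = 0"
      by (simp add: add.assoc)
    \<comment> \<open>\<open>s ?p\<close> and \<open>\<i> *s s ?p\<close> are orthonormal and both
      orthogonal to \<open>w\<close>, so pairing \<open>eq'\<close> with each of them isolates one
      part of \<open>v $ k\<close>.\<close>
    have "Re (v $ k) = 0"
      using arg_cong[OF eq', of "\<lambda>x. s ?p \<bullet> x"] w nrm
      by (simp add: inner_add_right mem_xi0 inner_i_right alpha0_self)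
    moreover have "Im (v $ k) = 0"
      using arg_cong[OF eq', of "\<lambda>x. (\<i> *s s ?p) \<bullet> x"] w nrm
      by (simp add: inner_add_right mem_xi0 alpha0_eq_inner[symmetric] alpha0_self alpha0_i_right)
    ultimately have vk: "v $ k = 0" by (simp add: complex_eq_iff)
    then have "w = 0" using eq by simp
    then have "?D u = \<i> *s ?D (\<i> *s u)" by (simp add: w2)
    then have Diu: "?D (\<i> *s u) = - (\<i> *s ?D u)"
      by (simp add: i_i)
    have "alpha0 (?D u) (?D (\<i> *s u)) = - (?D u \<bullet> ?D u)"
      unfolding Diu bounded_bilinear.minus_right[OF bounded_bilinear_alpha0] by (simp add: alpha0_i_right)
    then have "conformal_factor s ?p * (u \<bullet> u) \<le> 0"
      using contacto_conformally_symplectic[OF s p u xi0_i[OF u]] by (simp add: alpha0_i_right)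
    then have "u \<bullet> u \<le> 0" using pos by (simp add: mult_le_0_iff)
    then have "u = 0" by (metis inner_gt_zero_iff not_less)
    then show "v = 0" using vk by (simp add: u_def vec_eq_iff) metis
  qed
  then have "\<exists>B. B ** jet_matrix k s = mat 1"
    unfolding matrix_left_invertible_ker by blast
  then show ?thesis
    by (simp add: invertible_det_nz[symmetric] invertible_left_inverse)
qed

section \<open>Continuity and non-vanishing in families\<close>

text \<open>Evaluation at one point is dominated by the sup-seminorm over the sphere, so the
  \<open>cinf_ball\<close> for the same list \<open>vs\<close> is mapped into a given ball around
  the value.\<close>

lemma continuous_map_dir_derivs:
  fixes z :: "'a::euclidean_space"
  assumes z: "z \<in> sphere 0 1"
  shows "continuous_map cinf_topology euclidean (\<lambda>s. dir_derivs vs (s \<circ> sgn) z)"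
  unfolding continuous_map_def
proof (intro conjI allI impI)
  fix W :: "'a set" assume "openin euclidean W"
  then have W: "open W" by simp
  let ?A = "{s \<in> topspace cinf_topology. dir_derivs vs (s \<circ> sgn) z \<in> W}"
  have "\<exists>B. openin cinf_topology B \<and> s \<in> B \<and> B \<subseteq> ?A" if s: "s \<in> ?A" for s
  proof -
    obtain e where e: "e > 0" "ball (dir_derivs vs (s \<circ> sgn) z) e \<subseteq> W"
      using s openE[OF W] by blast
    have sd: "s \<in> diffeos (sphere 0 1)" using s by (simp add: topspace_cinf_topology)
    have "openin cinf_topology (cinf_ball s vs e)"
      unfolding cinf_topology_def using sd e(1) by (intro topology_generated_by_Basis) blast
    moreover have "s \<in> cinf_ball s vs e" using sd e(1) by (simp add: cinf_ball_def)
    moreover have "cinf_ball s vs e \<subseteq> ?A"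
    proof
      fix g assume g: "g \<in> cinf_ball s vs e"
      then have "dist (dir_derivs vs (s \<circ> sgn) z) (dir_derivs vs (g \<circ> sgn) z) < e"
        using z by (simp add: cinf_ball_def dist_norm norm_minus_commute)
      then show "g \<in> ?A"
        using g e(2) by (auto simp: cinf_ball_def topspace_cinf_topology)
    qed
    ultimately show ?thesis by blast
  qed
  then show "openin cinf_topology ?A"
    by (subst openin_subopen) blast
qed simp

context
  fixes T :: "'a::topological_space set" and H :: "'a \<Rightarrow> complex ^ 'n \<Rightarrow> complex ^ 'n"
  assumes H: "continuous_map (top_of_set T) Cont_sphere H"
begin

lemma continuous_on_dir_derivs:
  assumes "z \<in> sphere 0 1"
  shows "continuous_on T (\<lambda>x. dir_derivs vs (H x \<circ> sgn) z)"
proof -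
  have "continuous_map (top_of_set T) cinf_topology H"
    using H by (simp add: Cont_sphere_def continuous_map_in_subtopology)
  then have "continuous_map (top_of_set T) euclidean ((\<lambda>s. dir_derivs vs (s \<circ> sgn) z) \<circ> H)"
    by (rule continuous_map_compose[OF _ continuous_map_dir_derivs[OF assms]])
  then show ?thesis by (simp add: comp_def[of _ H])
qed

lemma continuous_on_eval: "z \<in> sphere 0 1 \<Longrightarrow> continuous_on T (\<lambda>x. H x z)"
  using continuous_on_dir_derivs[of z "[]"] by (simp add: sgn_div_norm)

lemma continuous_on_sphere_differential:
  "z \<in> sphere 0 1 \<Longrightarrow> continuous_on T (\<lambda>x. sphere_differential (H x) z v)"
  using continuous_on_dir_derivs[of z "[v]"] by (simp add: sphere_differential_def)

lemma continuous_on_det_jet_matrix: "continuous_on T (\<lambda>x. det (jet_matrix k (H x)))"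
proof -
  have "continuous_on T (\<lambda>x. jet_matrix k (H x) $ i $ j)" for i j
    by (cases "j = k") (simp_all add: jet_matrix_def continuous_intros continuous_on_eval
        continuous_on_sphere_differential axis_in_sphere)
  then show ?thesis
    unfolding det_def
    by (intro continuous_on_sum continuous_on_mult continuous_on_prod continuous_on_const)
qed

text \<open>The conformal factor never vanishes, so along a connected family its sign is constant.\<close>

lemma conformal_factor_pos:
  assumes "connected T" "x0 \<in> T" "H x0 = id_sphere" "x \<in> T"
  shows "conformal_factor (H x) (axis k 1) > 0"
proof -
  let ?p = "axis k (1::complex)" and ?f = "\<lambda>x. conformal_factor (H x) (axis k 1)"
  note p = axis_in_sphere[of k]
  have cont: "continuous_on T ?f"
    unfolding conformal_factor_def
    by (intro bounded_bilinear.continuous_on[OF bounded_bilinear_alpha0] continuous_on_eval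
        continuous_on_sphere_differential p)
  have "H y \<in> contactomorphisms" if "y \<in> T" for y
    using H that by (auto simp: Cont_sphere_def continuous_map_in_subtopology)
  then have nz: "?f y \<noteq> 0" if "y \<in> T" for y
    using conformal_factor_nonzero p that by blast
  have "sphere_differential id_sphere ?p = (\<lambda>v. v - (?p \<bullet> v) *\<^sub>R ?p)"
  proof -
    have "((id_sphere \<circ> sgn) has_derivative (\<lambda>v. v - (?p \<bullet> v) *\<^sub>R ?p)) (at ?p)"
      by (rule has_derivative_transform_within_open[OF sgn_has_derivative_sphere[OF p], of "- {0}"])
        (auto simp: id_sphere_def norm_sgn)
    then show ?thesis
      unfolding sphere_differential_def using frechet_derivative_at by metis
  qed
  then have "?f x0 = 1"
    using p by (simp add: assms(3) conformal_factor_def id_sphere_def alpha0_i_right inner_i_right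
        alpha0_self dot_square_norm)
  have "connected (?f ` T)" using connected_continuous_image[OF cont assms(1)] .
  moreover have "?f x \<in> ?f ` T" "1 \<in> ?f ` T"
    using assms(2,4) \<open>?f x0 = 1\<close> by (metis imageI)+
  moreover have "0 \<notin> ?f ` T" using nz by auto
  ultimately have "\<not> ?f x \<le> 0"
    using connectedD_interval[of "?f ` T" "?f x" 1 0] zero_le_one by blast
  then show ?thesis by simp
qed

lemma det_jet_matrix_family_nonzero:
  assumes "connected T" "x0 \<in> T" "H x0 = id_sphere" "x \<in> T"
  shows "det (jet_matrix k (H x)) \<noteq> 0"
proof -
  have "H x \<in> contactomorphisms"
    using H assms(4) by (auto simp: Cont_sphere_def continuous_map_in_subtopology)
  then show ?thesis by (rule det_jet_matrix_nonzero[OF _ conformal_factor_pos[OF assms]])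
qed

end

section \<open>The Reeb loop\<close>

lemma dir_derivs_bounded_linear:
  assumes L: "bounded_linear L" and f: "smooth_on_open U f" and x: "x \<in> U"
  shows "dir_derivs vs (\<lambda>y. L (f y)) x = L (dir_derivs vs f x)"
  using x
proof (induction vs arbitrary: x)
  case (Cons v vs)
  have U: "open U" using f by (simp add: smooth_on_open_def)
  have "(dir_derivs vs f has_derivative frechet_derivative (dir_derivs vs f) (at x)) (at x)"
    using f Cons.prems by (simp add: smooth_on_open_def frechet_derivative_works)
  then have "((\<lambda>y. L (dir_derivs vs f y)) has_derivative (\<lambda>v. L (frechet_derivative (dir_derivs vs f) (at x) v))) (at x)"
    by (rule bounded_linear.has_derivative[OF L])
  then have "(dir_derivs vs (\<lambda>y. L (f y)) has_derivative (\<lambda>v. L (frechet_derivative (dir_derivs vs f) (at x) v))) (at x)"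
    by (rule has_derivative_transform_within_open[OF _ U Cons.prems]) (simp add: Cons.IH)
  then show ?case by (simp add: frechet_derivative_at[symmetric])
qed simp

lemma smooth_on_open_sgn: "smooth_on_open (- {0}) (sgn :: 'a::euclidean_space \<Rightarrow> 'a)"
  by (simp add: smooth_on_open_iff diffk_sgn open_Compl)

lemma continuous_on_dir_derivs_smooth:
  "smooth_on_open U f \<Longrightarrow> continuous_on U (dir_derivs vs f)"
  unfolding smooth_on_open_def
  by (meson continuous_at_imp_continuous_on differentiable_imp_continuous_within)

section \<open>The Reeb flow as a family of contactomorphisms\<close>

lemma cis_smult_sphere: "z \<in> sphere 0 1 \<Longrightarrow> cis t *s z \<in> sphere 0 1"
  by (simp add: norm_vec_def norm_mult)

lemma reeb_flow_add: "z \<in> sphere 0 1 \<Longrightarrow> reeb_flow a (reeb_flow b z) = reeb_flow (a + b) z"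
  using cis_smult_sphere[of z b] by (simp add: reeb_flow_def vector_smult_assoc cis_mult)

lemma reeb_flow_diffeo: "reeb_flow t \<in> diffeos (sphere 0 1)"
proof -
  have sm: "smooth_map_on (sphere 0 1) s" if "\<And>z. z \<in> sphere 0 1 \<Longrightarrow> s z = reeb_flow a z"
    for s :: "complex ^ 'n \<Rightarrow> complex ^ 'n" and a
    by (rule smooth_map_on_bounded_linear[OF bounded_linear_vector_smult[of "cis a"]])
      (simp add: that reeb_flow_def)
  have inv: "reeb_flow (- t) (reeb_flow t z) = z" "reeb_flow t (reeb_flow (- t) z) = z"
    if "z \<in> sphere 0 1" for z :: "complex ^ 'n"
    using that by (simp_all add: reeb_flow_add reeb_flow_is_flow(1))
  have bij: "bij_betw (reeb_flow t) (sphere 0 1) (sphere 0 1 :: (complex ^ 'n) set)"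
    by (rule bij_betw_byWitness[where f' = "reeb_flow (- t)"])
      (use inv reeb_flow_is_flow(2) in blast)+
  have "inv_into (sphere 0 1) (reeb_flow t) z = reeb_flow (- t) z" if "z \<in> sphere 0 1" for z :: "complex ^ 'n"
    using bij inv(2)[OF that] reeb_flow_is_flow(2)[OF that, of "- t"]
    by (metis bij_betw_def inv_into_f_f)
  then show ?thesis
    using bij sm by (auto simp: diffeos_def) (auto simp: reeb_flow_def)
qed

lemma reeb_flow_sgn: "z \<noteq> 0 \<Longrightarrow> (reeb_flow t \<circ> sgn) z = cis t *s sgn z"
  by (simp add: reeb_flow_def norm_sgn)

text \<open>A fixed linear map commutes with differentiation, so time enters the derivatives of
  every order only through the scalar \<open>cis t\<close>. Continuity of the flow in
  \<open>t\<close> rests on this.\<close>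

lemma dir_derivs_reeb_flow:
  assumes "z \<noteq> 0"
  shows "dir_derivs vs (reeb_flow t \<circ> sgn) z = cis t *s dir_derivs vs sgn z"
proof -
  have "dir_derivs vs (reeb_flow t \<circ> sgn) z = dir_derivs vs (\<lambda>y. cis t *s sgn y) z"
    by (rule dir_derivs_cong_open[of "- {0}"]) (use assms in \<open>auto simp: reeb_flow_sgn[unfolded o_def]\<close>)
  also have "\<dots> = cis t *s dir_derivs vs sgn z"
    by (rule dir_derivs_bounded_linear[OF bounded_linear_vector_smult smooth_on_open_sgn]) (use assms in simp)
  finally show ?thesis .
qed

lemma sphere_differential_reeb_flow:
  assumes "z \<in> sphere 0 1"
  shows "sphere_differential (reeb_flow t) z v = cis t *s (v - (z \<bullet> v) *\<^sub>R z)"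
proof -
  have "z \<noteq> 0" using assms by auto
  then show ?thesis
    using dir_derivs_reeb_flow[of z "[v]" t] dir_derivs_single[OF sgn_has_derivative_sphere[OF assms]]
    by (simp add: sphere_differential_def)
qed

text \<open>Multiplication by \<open>cis t\<close> is unitary and commutes with \<open>\<i>\<close>,
  so it preserves the inner product and \<open>alpha0\<close>, which cut out \<open>xi0\<close>; on
  \<open>xi0 z\<close> the projection in the differential is the identity.\<close>

lemma reeb_flow_contacto: "reeb_flow t \<in> contactomorphisms"
proof -
  have c: "(cis a *s u) \<bullet> (cis a *s w) = u \<bullet> w" for a and u w :: "complex ^ 'n"
  proof -
    have "(cis a * x) \<bullet> (cis a * y) = x \<bullet> y" for x y
    proof -
      have "(cis a * x) \<bullet> (cis a * y) = Re ((cis a * x) * cnj (cis a * y))" by (simp add: inner_complex_def algebra_simps)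
      also have "(cis a * x) * cnj (cis a * y) = (cis a * cnj (cis a)) * (x * cnj y)" by (simp add: mult_ac)
      also have "cis a * cnj (cis a) = 1" by (simp add: cis_cnj cis_mult)
      finally show ?thesis by (simp add: inner_complex_def)
    qed
    then show ?thesis by (simp add: inner_vec_def)
  qed
  have i: "\<i> *s (cis a *s u) = cis a *s (\<i> *s u)" for a and u :: "complex ^ 'n"
    by (simp add: vector_smult_assoc mult.commute)
  have xi: "cis a *s v \<in> xi0 (cis a *s z) \<longleftrightarrow> v \<in> xi0 z" for a and v z :: "complex ^ 'n"
    by (simp only: mem_xi0 alpha0_eq_inner i c)
  have "sphere_differential (reeb_flow t) z ` xi0 z = xi0 (reeb_flow t z)"
    if z: "z \<in> sphere 0 1" for z :: "complex ^ 'n"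
  proof -
    have "sphere_differential (reeb_flow t) z ` xi0 z = (\<lambda>v. cis t *s v) ` xi0 z"
      by (rule image_cong) (auto simp: sphere_differential_reeb_flow[OF z] mem_xi0)
    also have "\<dots> = xi0 (cis t *s z)"
    proof
      show "(\<lambda>v. cis t *s v) ` xi0 z \<subseteq> xi0 (cis t *s z)" using xi by auto
      show "xi0 (cis t *s z) \<subseteq> (\<lambda>v. cis t *s v) ` xi0 z"
      proof
        fix w assume w: "w \<in> xi0 (cis t *s z)"
        have eq: "w = cis t *s (cis (- t) *s w)" by (simp add: vector_smult_assoc cis_mult)
        then have "cis (- t) *s w \<in> xi0 z" using w xi[of t "cis (- t) *s w" z] by simp
        then show "w \<in> (\<lambda>v. cis t *s v) ` xi0 z" using eq by blast
      qed
    qed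
    finally show ?thesis using z by (simp add: reeb_flow_def)
  qed
  then show ?thesis unfolding contactomorphisms_def using reeb_flow_diffeo by blast
qed

section \<open>Continuity of the Reeb flow in the smooth topology\<close>

text \<open>A form of the tube lemma: the complement is the projection of a closed set along the
  compact factor \<open>K\<close>, hence closed.\<close>

lemma openin_parameters_compact:
  fixes F :: "'a::euclidean_space \<times> 'b::euclidean_space \<Rightarrow> real"
  assumes "compact K" "continuous_on (K \<times> UNIV) F"
  shows "open {t. \<forall>z\<in>K. F (z, t) < e}"
proof -
  let ?C = "K \<times> UNIV \<inter> F -` {e..}"
  have "closed ?C"
    by (rule continuous_closed_preimage[OF assms(2)]) (auto intro: closed_Times compact_imp_closed assms(1))
  then have "closed {t. \<exists>z. z \<in> K \<and> (z, t) \<in> ?C}"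
    by (rule closed_compact_projection[OF assms(1)])
  moreover have "{t. \<forall>z\<in>K. F (z, t) < e} = - {t. \<exists>z. z \<in> K \<and> (z, t) \<in> ?C}"
    by (auto simp: not_le)
  ultimately show ?thesis by (simp add: open_Compl)
qed

text \<open>It suffices to test subbasic balls. The preimage of one consists of the times at which
  an error that is jointly continuous in point and time stays below \<open>e\<close> on the whole
  compact sphere.\<close>

lemma continuous_map_reeb_flow:
  "continuous_map euclidean (Cont_sphere :: (complex ^ 'n \<Rightarrow> complex ^ 'n) topology) reeb_flow"
  unfolding Cont_sphere_def continuous_map_in_subtopology
proof
  show "continuous_map euclidean cinf_topology (reeb_flow :: real \<Rightarrow> complex ^ 'n \<Rightarrow> complex ^ 'n)"
    unfolding cinf_topology_def
  proof (rule continuous_on_generated_topo)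
    fix B :: "(complex ^ 'n \<Rightarrow> complex ^ 'n) set"
    assume "B \<in> {cinf_ball f vs e |f vs e. f \<in> diffeos (sphere 0 1) \<and> 0 < e}"
    then obtain f vs e where B: "B = cinf_ball f vs e" "f \<in> diffeos (sphere 0 1)" by blast
    let ?K = "sphere 0 1 :: (complex ^ 'n) set"
    let ?F = "\<lambda>(z, t). norm (cis t *s dir_derivs vs sgn z - dir_derivs vs (f \<circ> sgn) z)"
    have K: "?K \<subseteq> - {0}" by auto
    have d: "continuous_on (?K \<times> UNIV) (\<lambda>p. dir_derivs vs g (fst p))"
      if "smooth_on_open (- {0}) g" for g :: "complex ^ 'n \<Rightarrow> complex ^ 'n"
      by (rule continuous_on_compose2[OF continuous_on_dir_derivs_smooth[OF that]])
        (use K in \<open>auto intro!: continuous_intros\<close>)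
    have "continuous_on (?K \<times> UNIV) (\<lambda>p. cis (snd p) *s dir_derivs vs sgn (fst p))"
      unfolding vector_scalar_mult_def
      by (intro continuous_on_vec_lambda continuous_intros continuous_on_component d smooth_on_open_sgn)
    then have "continuous_on (?K \<times> UNIV) ?F"
      unfolding case_prod_beta by (intro continuous_intros d diffeo_smooth[OF B(2)])
    then have "open {t. \<forall>z\<in>?K. ?F (z, t) < e}"
      by (rule openin_parameters_compact[OF compact_sphere])
    also have "{t. \<forall>z\<in>?K. ?F (z, t) < e} = reeb_flow -` B"
    proof -
      have "dir_derivs vs (reeb_flow t \<circ> sgn) z = cis t *s dir_derivs vs sgn z"
        if "z \<in> ?K" for z t
        using that K by (intro dir_derivs_reeb_flow) auto
      then show ?thesis by (simp add: B cinf_ball_def reeb_flow_diffeo vimage_def)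
    qed
    finally show "openin euclidean (reeb_flow -` B \<inter> topspace euclidean)" by simp
  next
    show "reeb_flow ` topspace euclidean \<subseteq> \<Union> {cinf_ball f vs e |f vs e.
      f \<in> diffeos (sphere 0 1 :: (complex ^ 'n) set) \<and> 0 < e}"
    proof -
      have "\<Union> {cinf_ball f vs e |f vs e. f \<in> diffeos (sphere 0 1 :: (complex ^ 'n) set) \<and> 0 < e}
        = diffeos (sphere 0 1)"
        using topspace_cinf_topology[where 'a = "complex ^ 'n"]
        unfolding cinf_topology_def topology_generated_by_topspace .
      then show ?thesis by (simp add: image_subset_iff reeb_flow_diffeo)
    qed
  qed
qed (simp add: reeb_flow_contacto)

lemma loop_at_reeb_loop: "loop_at (Cont_sphere :: (complex ^ 'n \<Rightarrow> complex ^ 'n) topology) id_sphere reeb_loop"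
proof -
  have "continuous_map (top_of_set {0..1}) euclidean (\<lambda>t::real. 2 * pi * t)"
    unfolding continuous_map_iff_continuous by (intro continuous_intros)
  then have "continuous_map (top_of_set {0..1}) (Cont_sphere :: (complex ^ 'n \<Rightarrow> complex ^ 'n) topology)
      (reeb_flow \<circ> (\<lambda>t. 2 * pi * t))"
    by (rule continuous_map_compose[OF _ continuous_map_reeb_flow])
  then show ?thesis
    by (simp add: loop_at_def pathin_def reeb_loop_def[abs_def] comp_def[of reeb_flow])
      (simp add: reeb_flow_def id_sphere_def)
qed

text \<open>Vectors orthogonal to the base point are multiplied by \<open>cis t\<close>, which is
  already complex-linear, and the base point moves to \<open>cis t\<close> times itself. The jet
  matrix is thus \<open>cis t\<close> times the identity.\<close>

lemma det_jet_matrix_reeb_flow: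
  "det (jet_matrix k (reeb_flow t :: complex ^ 'n \<Rightarrow> complex ^ 'n)) = cis t ^ CARD('n)"
proof -
  have D: "sphere_differential (reeb_flow t) (axis k 1) (axis j c) = cis t *s axis j c"
    if "j \<noteq> k" for j :: 'n and c
    using that by (simp add: sphere_differential_reeb_flow[OF axis_in_sphere] inner_axis_axis)
  have "jet_matrix k (reeb_flow t) $ i $ j = (if i = j then cis t else 0)" for i j :: 'n
  proof -
    have "jet_matrix k (reeb_flow t) $ i $ j = (cis t *s axis j 1) $ i"
    proof (cases "j = k")
      case True
      then show ?thesis using axis_in_sphere[of k] by (simp add: jet_matrix_def reeb_flow_def)
    next
      case False
      then show ?thesis by (simp add: jet_matrix_def D) (simp add: axis_def complex_eq_iff)
    qed
    then show ?thesis by (simp add: axis_def)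
  qed
  then have "det (jet_matrix k (reeb_flow t :: complex ^ 'n \<Rightarrow> complex ^ 'n)) = (\<Prod>i\<in>(UNIV :: 'n set). cis t)"
    by (subst det_diagonal) auto
  then show ?thesis by simp
qed

section \<open>The winding number\<close>

text \<open>Each new copy is appended on the right, the order in which \<open>[^]\<close> multiplies
  in a monoid, so classes of iterates match powers of the class step by step.\<close>

primrec iterated_loop :: "nat \<Rightarrow> 'a \<Rightarrow> (real \<Rightarrow> 'a) \<Rightarrow> real \<Rightarrow> 'a"
  where
    "iterated_loop 0 a p = (\<lambda>_. a)"
  | "iterated_loop (Suc m) a p = loop_concat (iterated_loop m a p) p"

lemma loop_at_iterated_loop:
  assumes "loop_at X a p"
  shows "loop_at X a (iterated_loop m a p)"
proof (induction m)
  case 0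
  have "continuous_map (top_of_set {0..1}) X p" "p 0 = a"
    using assms by (simp_all add: loop_at_def pathin_def)
  then have "a \<in> topspace X" by (force simp: continuous_map_def)
  then show ?case by (simp add: loop_at_const)
qed (simp add: loop_concat_loop assms)

lemma fundamental_group_pow:
  assumes "loop_at X a p"
  shows "loop_class X a p [^]\<^bsub>fundamental_group X a\<^esub> m = loop_class X a (iterated_loop m a p)"
  by (induction m)
    (simp_all add: nat_pow_def fundamental_group_simps fundamental_group_mult assms loop_at_iterated_loop)

section \<open>Winding numbers of determinant loops\<close>

context
  fixes k :: "'n::finite"
begin

lemma path_det_jet_matrix:
  assumes "loop_at (Cont_sphere :: (complex ^ 'n \<Rightarrow> complex ^ 'n) topology) id_sphere p"
  shows "path (\<lambda>t. det (jet_matrix k (p t)))" "0 \<notin> path_image (\<lambda>t. det (jet_matrix k (p t)))"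
proof -
  have p: "continuous_map (top_of_set {0..1}) Cont_sphere p" "p 0 = id_sphere"
    using assms by (simp_all add: loop_at_def pathin_def)
  show "path (\<lambda>t. det (jet_matrix k (p t)))"
    unfolding path_def by (rule continuous_on_det_jet_matrix[OF p(1)])
  show "0 \<notin> path_image (\<lambda>t. det (jet_matrix k (p t)))"
    using det_jet_matrix_family_nonzero[OF p(1) _ _ p(2), of _ k] by (auto simp: path_image_def)
qed

text \<open>The square of parameters is connected and has the identity map at a corner, so the
  determinant vanishes nowhere on it. Applied to the homotopy, it gives a homotopy of paths in the
  punctured plane.\<close>

lemma winding_number_homotopic_loops_Cont:
  assumes "loop_homotopic (Cont_sphere :: (complex ^ 'n \<Rightarrow> complex ^ 'n) topology) id_sphere p q"
  shows "winding_number (\<lambda>t. det (jet_matrix k (p t))) 0 = winding_number (\<lambda>t. det (jet_matrix k (q t))) 0"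
proof -
  obtain h where h: "continuous_map (prod_topology (top_of_set {0..1}) (top_of_set {0..1}))
      (Cont_sphere :: (complex ^ 'n \<Rightarrow> complex ^ 'n) topology) h"
    "\<And>x. h (0, x) = p x" "\<And>x. h (1, x) = q x"
    "\<And>t. t \<in> {0..1::real} \<Longrightarrow> h (t, 0) = id_sphere \<and> h (t, 1::real) = id_sphere"
    using assms unfolding loop_homotopic_def homotopic_with_def by (metis (no_types, lifting))
  let ?Q = "{0..1::real} \<times> {0..1::real}" and ?d = "\<lambda>y. det (jet_matrix k (h y))"
  have H: "continuous_map (top_of_set ?Q) (Cont_sphere :: (complex ^ 'n \<Rightarrow> complex ^ 'n) topology) h"
    using h(1) by simp
  have "connected ?Q" by (intro connected_Times) auto
  then have nz: "?d y \<noteq> 0" if "y \<in> ?Q" for y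
    using det_jet_matrix_family_nonzero[OF H, of "(0, 0)" y k] h(4)[of 0] that by auto
  have c: "continuous_on ?Q ?d" by (rule continuous_on_det_jet_matrix[OF H])
  have "homotopic_paths (- {0}) (\<lambda>t. det (jet_matrix k (p t))) (\<lambda>t. det (jet_matrix k (q t)))"
    unfolding homotopic_paths
  proof (intro exI[of _ ?d] conjI)
    show "?d \<in> ?Q \<rightarrow> - {0}" using nz by auto
  qed (use c h in \<open>auto simp: pathstart_def pathfinish_def simp flip: h(2)\<close>)
  then show ?thesis by (rule winding_number_homotopic_paths)
qed

text \<open>Along the loop the determinant is \<open>exp \<circ> ?q\<close>, and its winding number
  around 0 is the increment of the exponent divided by \<open>2 * pi * \<i>\<close>.\<close>

lemma winding_number_reeb_loop:
  "winding_number (\<lambda>t. det (jet_matrix k (reeb_loop t :: complex ^ 'n \<Rightarrow> complex ^ 'n))) 0 = of_nat CARD('n)"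
proof -
  let ?q = "\<lambda>t. of_nat CARD('n) * (\<i> * of_real (2 * pi * t))"
  have "(\<lambda>t. det (jet_matrix k (reeb_loop t :: complex ^ 'n \<Rightarrow> complex ^ 'n))) = exp \<circ> ?q"
    by (simp add: fun_eq_iff reeb_loop_def det_jet_matrix_reeb_flow cis_conv_exp exp_of_nat_mult)
  moreover have "path ?q" unfolding path_def by (intro continuous_intros)
  ultimately show ?thesis
    using winding_number_compose_exp[of ?q] by (simp add: pathfinish_def pathstart_def)
qed

lemma winding_number_iterated_reeb_loop:
  "winding_number (\<lambda>t. det (jet_matrix k (iterated_loop m id_sphere reeb_loop t))) 0 = of_nat (m * CARD('n))"
proof (induction m)
  case 0
  let ?c = "det (jet_matrix k id_sphere)"
  have c: "?c \<noteq> 0"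
    using path_det_jet_matrix(2)[OF loop_at_iterated_loop[OF loop_at_reeb_loop], of 0]
    by (auto simp: path_image_def)
  \<comment> \<open>The constant loop is treated as a degenerate segment that avoids 0.\<close>
  have "winding_number (linepath ?c ?c) 0 = 0" using c by (intro winding_number_trivial) auto
  then show ?case by (simp add: linepath_refl)
next
  case (Suc m)
  let ?d = "\<lambda>p t. det (jet_matrix k (p t))"
  let ?p = "iterated_loop m id_sphere reeb_loop :: real \<Rightarrow> complex ^ 'n \<Rightarrow> complex ^ 'n"
  have p: "loop_at (Cont_sphere :: (complex ^ 'n \<Rightarrow> complex ^ 'n) topology) id_sphere ?p"
    by (rule loop_at_iterated_loop[OF loop_at_reeb_loop])
  \<comment> \<open>\<open>loop_concat\<close> and \<open>+++\<close> are given by the same formula,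
    so this is an equality of functions and winding numbers add.\<close>
  have "?d (iterated_loop (Suc m) id_sphere reeb_loop) = ?d ?p +++ ?d reeb_loop"
    by (auto simp: fun_eq_iff loop_concat_def joinpaths_def)
  moreover have "pathfinish (?d ?p) = pathstart (?d reeb_loop)"
    using p loop_at_reeb_loop[where 'n = 'n] by (simp add: loop_at_def pathfinish_def pathstart_def)
  ultimately show ?case
    using Suc winding_number_join[OF path_det_jet_matrix[OF p] path_det_jet_matrix[OF loop_at_reeb_loop]]
    by (simp add: winding_number_reeb_loop algebra_simps)
qed

end

theorem corollary2:
  fixes n :: nat
  assumes "CARD('n::finite) = n + 1" and "n \<noteq> 3"
  shows "let X = (Cont_sphere :: (complex ^ 'n \<Rightarrow> complex ^ 'n) topology);
             G = fundamental_group X id_sphere;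
             c = loop_class X id_sphere reeb_loop
         in c \<in> carrier G \<and> c \<noteq> \<one>\<^bsub>G\<^esub> \<and> (\<forall>k::nat. k > 0 \<longrightarrow> c [^]\<^bsub>G\<^esub> k \<noteq> \<one>\<^bsub>G\<^esub>)"
proof -
  let ?X = "Cont_sphere :: (complex ^ 'n \<Rightarrow> complex ^ 'n) topology"
  let ?G = "fundamental_group ?X id_sphere" and ?c = "loop_class ?X id_sphere reeb_loop"
  let ?p = "\<lambda>m. iterated_loop m id_sphere reeb_loop :: real \<Rightarrow> complex ^ 'n \<Rightarrow> complex ^ 'n"
  have pow: "?c [^]\<^bsub>?G\<^esub> m = loop_class ?X id_sphere (?p m)" for m :: nat
    by (rule fundamental_group_pow[OF loop_at_reeb_loop])
  have *: "?c [^]\<^bsub>?G\<^esub> m \<noteq> \<one>\<^bsub>?G\<^esub>" if "m > 0" for m :: nat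
  proof
    assume "?c [^]\<^bsub>?G\<^esub> m = \<one>\<^bsub>?G\<^esub>"
    \<comment> \<open>The trivial class is represented by the zeroth iterate, so one winding number
      formula serves both loops and compares \<open>m * CARD('n)\<close> with 0.\<close>
    then have "loop_class ?X id_sphere (?p m) = loop_class ?X id_sphere (?p 0)"
      by (simp add: pow fundamental_group_simps)
    then have "loop_homotopic ?X id_sphere (?p m) (?p 0)"
      using loop_class_eq_iff[OF loop_at_iterated_loop[OF loop_at_reeb_loop]] by blast
    then have "(of_nat (m * CARD('n)) :: complex) = of_nat (0 * CARD('n))"
      using winding_number_homotopic_loops_Cont winding_number_iterated_reeb_loop by metis
    then show False using that by simp
  qed
  have "?c \<in> carrier ?G" using loop_at_reeb_loop by (auto simp: fundamental_group_simps)
  moreover have "?c \<noteq> \<one>\<^bsub>?G\<^esub>"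
  proof
    assume "?c = \<one>\<^bsub>?G\<^esub>"
    then have "loop_homotopic ?X id_sphere reeb_loop (?p 0)"
      using loop_class_eq_iff[OF loop_at_reeb_loop[where 'n = 'n], of "?p 0"]
      by (simp add: fundamental_group_simps)
    then have "(of_nat CARD('n) :: complex) = of_nat (0 * CARD('n))"
      using winding_number_homotopic_loops_Cont winding_number_iterated_reeb_loop winding_number_reeb_loop
      by metis
    then show False by simp
  qed
  ultimately show ?thesis using * by (simp add: Let_def)
qed

end
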